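(* Let $\Delta\in\mathbb{N}$ and let $\mathcal{G}=(V,\mathcal{B},E)$ be a $2\Delta$-regular Borel graph. Then $\mathcal{G}$ admits approximate Schreier decoration: for every Borel probability measure $\mu$ on $(V,\mathcal{B})$ and every $\epsilon>0$ there is a partial Schreier decoration $(S,c)$ of $\mathcal{G}$ with $c;E\to\Delta$ such that $\mu(\mathbf{Corr}(S,c))>1-\epsilon$.
   Context: A Borel graph is a triple $\mathcal{G}=(V,\mathcal{B},E)$ where $(V,\mathcal{B})$ is a standard Borel space and $E\subseteq V\times V$ is a Borel, symmetric, irreflexive set. An orientation of $\mathcal{G}$ is a Borel set $S\subseteq E$ such that for every edge $\{x,y\}$ exactly one of $(x,y),(y,x)$ lies in $S$; $\operatorname{out}_S(v)=\{(v,x)\in S\}$, $\operatorname{in}_S(v)=\{(x,v)\in S\}$, $\mathbf{Corr}(S)=\{v:|\operatorname{in}_S(v)|=|\operatorname{out}_S(v)|\}$. For $k\in\mathbb{N}$ (identified with $\{0,\dots,k-1\}$), a partial edge coloring $c;E\to k$ is a Borel map with Borel domain $\operatorname{dom}(c)\subseteq E$ and $c(x,y)=c(y,x)$ whenever $(x,y)\in\operatorname{dom}(c)$. A partial Schreier decoration is a pair $(S,c)$ of an orientation $S$ and a partial edge coloring $c$; $v\in\mathbf{Corr}(S,c)$ means $v\in\mathbf{Corr}(S)$ and $c$ is defined and injective on each of $\operatorname{in}_S(v)$ and $\operatorname{out}_S(v)$. *)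

theory Defs
  imports "HOL-Probability.Probability" "HOL-Library.Equipollence"
begin

text \<open>Standard Borel spaces are modelled (up to Borel isomorphism) as a type
  of class polish_space equipped with its Borel sigma-algebra. Borel subsets of
  V x V are the sets of the product sigma-algebra borel x borel
  (equal to the Borel sets of V x V since V is second countable).\<close>

definition borel_graph :: "('a::polish_space \<times> 'a) set \<Rightarrow> bool" where
  "borel_graph E \<longleftrightarrow> E \<in> sets (borel \<Otimes>\<^sub>M borel)
     \<and> (\<forall>x y. (x, y) \<in> E \<longrightarrow> (y, x) \<in> E)
     \<and> (\<forall>x. (x, x) \<notin> E)"

definition regular_graph :: "nat \<Rightarrow> ('a \<times> 'a) set \<Rightarrow> bool" where
  "regular_graph d E \<longleftrightarrow> (\<forall>v. finite {w. (v, w) \<in> E} \<and> card {w. (v, w) \<in> E} = d)"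

definition orientation :: "('a::polish_space \<times> 'a) set \<Rightarrow> ('a \<times> 'a) set \<Rightarrow> bool" where
  "orientation E S \<longleftrightarrow> S \<in> sets (borel \<Otimes>\<^sub>M borel) \<and> S \<subseteq> E
     \<and> (\<forall>x y. (x, y) \<in> E \<longrightarrow> ((x, y) \<in> S \<longleftrightarrow> (y, x) \<notin> S))"

definition partial_edge_coloring ::
  "('a::polish_space \<times> 'a) set \<Rightarrow> nat \<Rightarrow> ('a \<times> 'a \<Rightarrow> nat option) \<Rightarrow> bool" where
  "partial_edge_coloring E k c \<longleftrightarrow>
     c \<in> measurable (borel \<Otimes>\<^sub>M borel) (count_space UNIV)
     \<and> dom c \<subseteq> E
     \<and> (\<forall>e i. c e = Some i \<longrightarrow> i < k)
     \<and> (\<forall>x y. (x, y) \<in> dom c \<longrightarrow> c (x, y) = c (y, x))"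

definition out_edges :: "('a \<times> 'a) set \<Rightarrow> 'a \<Rightarrow> ('a \<times> 'a) set" where
  "out_edges S v = {e \<in> S. fst e = v}"

definition in_edges :: "('a \<times> 'a) set \<Rightarrow> 'a \<Rightarrow> ('a \<times> 'a) set" where
  "in_edges S v = {e \<in> S. snd e = v}"

definition Corr :: "('a \<times> 'a) set \<Rightarrow> 'a set" where
  "Corr S = {v. in_edges S v \<approx> out_edges S v}"

definition Corr_dec :: "('a \<times> 'a) set \<Rightarrow> ('a \<times> 'a \<Rightarrow> nat option) \<Rightarrow> 'a set" where
  "Corr_dec S c = {v. v \<in> Corr S
      \<and> in_edges S v \<subseteq> dom c \<and> inj_on c (in_edges S v)
      \<and> out_edges S v \<subseteq> dom c \<and> inj_on c (out_edges S v)}"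

end

theory Submission
  imports Defs
begin

text \<open>The neighbours of a vertex can be enumerated by Borel functions, because for sets whose
  sections all have the same finite size both the projection and its complement are analytic.

  Pairing up the edge ends at every vertex and following edges decomposes the graph into lines and
  cycles, the orbits of two Borel involutions \<open>a\<close> and \<open>b\<close>. Such orbits can be two-coloured so that
  \<open>a\<close> always and \<open>b\<close> almost always changes the colour. No single choice works uniformly,
  but there are \<open>K\<close> choices such that every point fails for at most four of them, and averaging over
  the choices handles an arbitrary measure. Colouring edge ends by direction
  gives an almost balanced orientation.

  An almost \<open>k\<close>-regular orientation almost has a perfect matching from out-ends to in-ends: give all
  edges weight \<open>2 ^ t div k\<close>, put the remainder \<open>2 ^ t mod k\<close> on a fictitious loop at every vertex, and
  halve \<open>t\<close> times, rounding the odd weights up and down along the trails and always keeping the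
  half with less loop weight. In the end every good vertex has weight one, and loops survive only
  on a set of measure at most \<open>k / 2 ^ t\<close>. Removing matchings one by one yields the colours.\<close>

section \<open>Analytic sets and Lusin separation\<close>

text \<open>The measure is not assumed invariant: the neighbours of a small set of bad vertices may
  have large measure, so errors must never be moved along edges. Every estimate therefore charges a
  vertex only for what happens at that vertex, either by a count of failing choices valid at each
  single point or by the weight of the loop there. Exact alternation is out of reach in general: a
  Borel set changed by both \<open>a\<close> and \<open>b\<close> is invariant under
  \<open>a \<circ> b\<close>, and if \<open>a\<close> and \<open>b\<close> preserve a probability
  measure it has measure 1/2, which is impossible when \<open>a \<circ> b\<close> is ergodic.
  Matchings come from splitting weights because rounding along trails keeps the sums exact at every
  good vertex, whereas augmenting paths would carry errors through the graph. Powers of two keep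
  every intermediate sum even until it reaches one.\<close>

definition analytic :: "'w::topological_space set \<Rightarrow> bool" where
  "analytic A \<longleftrightarrow> (\<exists>F :: ('w \<times> (nat \<Rightarrow> real)) set. closed F \<and> A = fst ` F)"

lemma closed_imp_analytic: "closed A \<Longrightarrow> analytic A"
  unfolding analytic_def by (intro exI[of _ "A \<times> UNIV"]) (auto intro: closed_Times)

lemma analytic_UN:
  fixes A :: "nat \<Rightarrow> 'w::topological_space set"
  assumes "\<And>n. analytic (A n)"
  shows "analytic (\<Union>n. A n)"
proof -
  obtain F :: "nat \<Rightarrow> ('w \<times> (nat \<Rightarrow> real)) set"
    where F: "\<And>n. closed (F n)" "\<And>n. A n = fst ` F n"
    using assms unfolding analytic_def by metis
  define sh :: "'w \<times> (nat \<Rightarrow> real) \<Rightarrow> 'w \<times> (nat \<Rightarrow> real)" where "sh p = (fst p, \<lambda>i. snd p (Suc i))" for p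
  \<comment> \<open>Coordinate 0 names an index \<open>n\<close>, the others form a witness for
    \<open>A n\<close>. Infinite unions of closed sets need not be closed, so membership is written
    as an intersection of implications; among naturals, differing from \<open>n\<close> is the
    closed condition of lying at distance at least 1/2.\<close>
  define G where "G = {p. snd p 0 \<in> \<nat>} \<inter>
    (\<Inter>n. {p. 1/2 \<le> \<bar>snd p 0 - real n\<bar>} \<union> sh -` F n)"
  have coord: "continuous_on UNIV (\<lambda>p :: 'w \<times> (nat \<Rightarrow> real). snd p i)" for i
    by (rule continuous_on_product_then_coordinatewise) (intro continuous_intros)
  have sh: "continuous_on UNIV sh"
    unfolding sh_def by (intro continuous_intros coord)
  have "closed ((\<lambda>p :: 'w \<times> (nat \<Rightarrow> real). snd p 0) -` \<nat>)"
    by (intro closed_vimage coord) simp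
  moreover have "closed {p :: 'w \<times> (nat \<Rightarrow> real). 1/2 \<le> \<bar>snd p 0 - real n\<bar>}" for n
    by (intro closed_Collect_le continuous_intros coord)
  moreover have "closed (sh -` F n)" for n
    by (intro closed_vimage sh F)
  ultimately have "closed G"
    unfolding G_def by (intro closed_Int closed_INT ballI closed_Un) (auto simp: vimage_def)
  moreover have "(\<Union>n. A n) = fst ` G"
  proof (intro equalityI subsetI)
    fix x assume "x \<in> (\<Union>n. A n)"
    then obtain n a where na: "(x, a) \<in> F n" using F(2) by force
    define b where "b = (\<lambda>i. case i of 0 \<Rightarrow> real n | Suc j \<Rightarrow> a j)"
    have "1/2 \<le> \<bar>real n - real m\<bar> \<or> m = n" for m
      by (cases m n rule: linorder_cases) auto
    then have "(x, b) \<in> G"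
      unfolding G_def sh_def using na by (auto simp: b_def)
    then show "x \<in> fst ` G" by force
  next
    fix x assume "x \<in> fst ` G"
    then obtain b where b: "(x, b) \<in> G" by force
    then obtain n where "b 0 = real n" unfolding G_def by (auto elim: Nats_cases)
    with b have "sh (x, b) \<in> F n" unfolding G_def by force
    then show "x \<in> (\<Union>n. A n)" using F(2)[of n] by (force simp: sh_def)
  qed
  ultimately show ?thesis unfolding analytic_def by blast
qed

lemma analytic_INT:
  fixes A :: "nat \<Rightarrow> 'w::topological_space set"
  assumes "\<And>n. analytic (A n)"
  shows "analytic (\<Inter>n. A n)"
proof -
  obtain F :: "nat \<Rightarrow> ('w \<times> (nat \<Rightarrow> real)) set"
    where F: "\<And>n. closed (F n)" "\<And>n. A n = fst ` F n"
    using assms unfolding analytic_def by metis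
  \<comment> \<open>One sequence carries a witness for every \<open>n\<close>, interleaved by
    \<open>prod_encode\<close>.\<close>
  define sh :: "nat \<Rightarrow> 'w \<times> (nat \<Rightarrow> real) \<Rightarrow> 'w \<times> (nat \<Rightarrow> real)"
    where "sh n p = (fst p, \<lambda>i. snd p (prod_encode (n, i)))" for n p
  define G where "G = (\<Inter>n. sh n -` F n)"
  have coord: "continuous_on UNIV (\<lambda>p :: 'w \<times> (nat \<Rightarrow> real). snd p i)" for i
    by (rule continuous_on_product_then_coordinatewise) (intro continuous_intros)
  have "continuous_on UNIV (sh n)" for n
    unfolding sh_def by (intro continuous_intros coord)
  then have "closed G"
    unfolding G_def by (intro closed_INT ballI closed_vimage F)
  moreover have "(\<Inter>n. A n) = fst ` G"
  proof (intro equalityI subsetI)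
    fix x assume x: "x \<in> (\<Inter>n. A n)"
    have "\<exists>a. (x, a) \<in> F n" for n
      using x F(2)[of n] by force
    then obtain a where a: "\<And>n. (x, a n) \<in> F n" by metis
    have "(x, \<lambda>k. a (fst (prod_decode k)) (snd (prod_decode k))) \<in> G"
      unfolding G_def sh_def using a by auto
    then show "x \<in> fst ` G" by force
  next
    fix x assume "x \<in> fst ` G"
    then obtain b where b: "(x, b) \<in> G" by force
    show "x \<in> (\<Inter>n. A n)"
    proof
      fix n have "sh n (x, b) \<in> F n" using b unfolding G_def by auto
      then show "x \<in> A n" using F(2)[of n] by (force simp: sh_def)
    qed
  qed
  ultimately show ?thesis unfolding analytic_def by blast
qed

text \<open>Complements of analytic sets need not be analytic, so the induction carries both a set
  and its complement; complementation then only swaps them. Open sets are countable unions of closed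
  ones.\<close>

lemma borel_imp_analytic:
  fixes A :: "'w::metric_space set"
  assumes "A \<in> sets borel"
  shows "analytic A"
proof -
  have "A \<in> sigma_sets UNIV {S. open S}" using assms by (simp add: sets_borel)
  then have "analytic A \<and> analytic (- A)"
  proof (induction rule: sigma_sets.induct)
    case (Basic U)
    then have U: "open U" by simp
    define C where "C n = {x. inverse (real (Suc n)) \<le> infdist x (- U)}" for n
    have "analytic U" if "- U \<noteq> {}"
    proof -
      have "closed (C n)" for n
        unfolding C_def by (intro closed_Collect_le continuous_intros)
      moreover have "U = (\<Union>n. C n)"
      proof (intro equalityI subsetI)
        fix x assume x: "x \<in> U"
        have "infdist x (- U) > 0"
          using U x that in_closed_iff_infdist_zero[of "- U" x] infdist_nonneg[of x "- U"]
          by (fastforce simp: less_le)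
        then obtain n where "inverse (real (Suc n)) < infdist x (- U)"
          using reals_Archimedean by blast
        then show "x \<in> (\<Union>n. C n)" unfolding C_def by (auto intro: less_imp_le)
      next
        fix x assume "x \<in> (\<Union>n. C n)"
        then obtain n where "inverse (real (Suc n)) \<le> infdist x (- U)" unfolding C_def by auto
        moreover have "inverse (real (Suc n)) > 0" by simp
        ultimately have "infdist x (- U) \<noteq> 0" by linarith
        then show "x \<in> U" using infdist_zero by force
      qed
      ultimately show ?thesis by (metis analytic_UN closed_imp_analytic)
    qed
    \<comment> \<open>Here \<open>infdist\<close> is 0 by convention, so the sets \<open>C n\<close>
      would be empty instead of covering \<open>U\<close>.\<close>
    moreover have "analytic U" if "- U = {}"
      using that closed_imp_analytic[of UNIV] by (metis closed_UNIV double_compl Compl_empty_eq)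
    ultimately show ?case using U closed_imp_analytic[of "- U"] by auto
  next
    case Empty
    then show ?case using closed_imp_analytic[of "{}"] closed_imp_analytic[of UNIV] by simp
  next
    case (Compl a)
    then show ?case by (simp add: Compl_eq_Diff_UNIV[symmetric])
  next
    case (Union A)
    then show ?case by (auto intro: analytic_UN analytic_INT)
  qed
  then show ?thesis ..
qed

section \<open>Separation of disjoint analytic sets by Borel sets\<close>

definition borel_separated :: "'a::topological_space set \<Rightarrow> 'a set \<Rightarrow> bool" where
  "borel_separated A B \<longleftrightarrow> (\<exists>C\<in>sets borel. A \<subseteq> C \<and> C \<inter> B = {})"

text \<open>Used in contrapositive form: if two countable unions cannot be separated, neither can
  some pair of their pieces, so inseparability descends to small sets.\<close>

lemma borel_separated_UN:
  fixes A B :: "nat \<Rightarrow> 'a::topological_space set"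
  assumes "\<And>i j. borel_separated (A i) (B j)"
  shows "borel_separated (\<Union>i. A i) (\<Union>j. B j)"
proof -
  obtain C where C: "\<And>i j. C i j \<in> sets borel" "\<And>i j. A i \<subseteq> C i j" "\<And>i j. C i j \<inter> B j = {}"
    using assms unfolding borel_separated_def by metis
  show ?thesis unfolding borel_separated_def
  proof
    show "(\<Union>i. \<Inter>j. C i j) \<in> sets borel" using C(1) by auto
    have "A i \<subseteq> (\<Inter>j. C i j)" "(\<Inter>j. C i j) \<inter> B k = {}" for i k
      using C(2)[of i] C(3)[of i k] by auto
    then show "\<Union> (range A) \<subseteq> (\<Union>i. \<Inter>j. C i j) \<and> (\<Union>i. \<Inter>j. C i j) \<inter> \<Union> (range B) = {}"
      by (simp add: Int_UN_distrib2 UN_mono)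
  qed
qed

lemma small_closed_cover:
  fixes F :: "'a::{metric_space, second_countable_topology} set"
  assumes "closed F" "e > 0"
  obtains C :: "nat \<Rightarrow> 'a set" where "\<And>i. closed (C i)" "F = (\<Union>i. C i)"
    "\<And>i x y. x \<in> C i \<Longrightarrow> y \<in> C i \<Longrightarrow> dist x y \<le> e"
proof -
  obtain D :: "'a set" where D: "countable D" "\<And>X. open X \<Longrightarrow> X \<noteq> {} \<Longrightarrow> \<exists>d\<in>D. d \<in> X"
    using countable_dense_setE by blast
  have "D \<noteq> {}" using D(2)[of UNIV] by auto
  define C where "C i = F \<inter> cball (from_nat_into D i) (e/2)" for i
  show thesis
  proof
    show "closed (C i)" for i unfolding C_def using assms by auto
    show "F = (\<Union>i. C i)"
    proof (intro equalityI subsetI)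
      fix x assume x: "x \<in> F"
      obtain d where "d \<in> D" "d \<in> ball x (e/2)"
        using D(2)[of "ball x (e/2)"] assms(2) by auto
      moreover from this obtain i where "from_nat_into D i = d"
        using D(1) by (metis from_nat_into_surj)
      ultimately show "x \<in> (\<Union>i. C i)" unfolding C_def using x by (auto simp: dist_commute intro!: exI[of _ i])
    qed (auto simp: C_def)
    show "dist x y \<le> e" if "x \<in> C i" "y \<in> C i" for i x y
      using that dist_triangle3[of x y "from_nat_into D i"] unfolding C_def by auto
  qed
qed

text \<open>Inseparability passes to ever smaller closed pieces of \<open>F\<close> and
  \<open>G\<close>, which shrink to points \<open>p\<close> and \<open>q\<close> by completeness. As
  \<open>f p\<close> and \<open>g q\<close> differ, disjoint open sets around them separate the
  images of late pieces.\<close>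

lemma lusin_separation:
  fixes f :: "'p::{complete_space, second_countable_topology} \<Rightarrow> 'x::t2_space"
    and g :: "'q::{complete_space, second_countable_topology} \<Rightarrow> 'x"
  assumes F: "closed F" and G: "closed G"
    and f: "continuous_on UNIV f" and g: "continuous_on UNIV g"
    and disj: "f ` F \<inter> g ` G = {}"
  shows "borel_separated (f ` F) (g ` G)"
proof (rule ccontr)
  assume nsep: "\<not> borel_separated (f ` F) (g ` G)"
  define P where "P n s \<longleftrightarrow> closed (fst s) \<and> closed (snd s) \<and> fst s \<subseteq> F \<and> snd s \<subseteq> G
     \<and> \<not> borel_separated (f ` fst s) (g ` snd s)" for n :: nat and s
  define Q where "Q n s t \<longleftrightarrow> fst t \<subseteq> fst s \<and> snd t \<subseteq> snd s
     \<and> (\<forall>x\<in>fst t. \<forall>y\<in>fst t. dist x y \<le> inverse (real (Suc n)))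
     \<and> (\<forall>x\<in>snd t. \<forall>y\<in>snd t. dist x y \<le> inverse (real (Suc n)))"
    for n and s t :: "'p set \<times> 'q set"
  have "\<exists>s. \<forall>n. P n (s n) \<and> Q n (s n) (s (Suc n))"
  proof (rule dependent_nat_choice)
    show "\<exists>s. P 0 s" using F G nsep unfolding P_def by (intro exI[of _ "(F, G)"]) auto
  next
    fix s n assume s: "P n s"
    define e where "e = inverse (real (Suc n))"
    have e: "e > 0" unfolding e_def by simp
    have clA: "closed (fst s)" using s unfolding P_def by simp
    obtain A :: "nat \<Rightarrow> 'p set" where A: "\<And>i. closed (A i)" "fst s = (\<Union>i. A i)"
      "\<And>i x y. x \<in> A i \<Longrightarrow> y \<in> A i \<Longrightarrow> dist x y \<le> e"
      by (rule small_closed_cover[OF clA e]) blast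
    have clB: "closed (snd s)" using s unfolding P_def by simp
    obtain B :: "nat \<Rightarrow> 'q set" where B: "\<And>i. closed (B i)" "snd s = (\<Union>i. B i)"
      "\<And>i x y. x \<in> B i \<Longrightarrow> y \<in> B i \<Longrightarrow> dist x y \<le> e"
      by (rule small_closed_cover[OF clB e]) blast
    have "\<not> borel_separated (\<Union>i. f ` A i) (\<Union>i. g ` B i)"
      using s unfolding P_def A(2) B(2) by (simp add: image_UN)
    then obtain i j where "\<not> borel_separated (f ` A i) (g ` B j)"
      using borel_separated_UN[of "\<lambda>i. f ` A i" "\<lambda>i. g ` B i"] by blast
    then show "\<exists>t. P (Suc n) t \<and> Q n s t"
    proof (intro exI conjI)
      have "A i \<subseteq> fst s" "B j \<subseteq> snd s" using A(2) B(2) by auto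
      then show "P (Suc n) (A i, B j)" "Q n s (A i, B j)"
        using A(1,3) B(1,3) s \<open>\<not> borel_separated (f ` A i) (g ` B j)\<close>
        unfolding P_def Q_def e_def by auto
    qed
  qed
  then obtain s where P: "\<And>n. P n (s n)" and Q: "\<And>n. Q n (s n) (s (Suc n))" by blast
  define A B where "A n = fst (s n)" and "B n = snd (s n)" for n
  have cl: "closed (A n)" "closed (B n)" and sub: "A n \<subseteq> F" "B n \<subseteq> G"
    and ns: "\<not> borel_separated (f ` A n) (g ` B n)" for n
    using P[of n] unfolding P_def A_def B_def by auto
  have ne: "A n \<noteq> {}" "B n \<noteq> {}" for n
  proof -
    show "A n \<noteq> {}" using ns[of n] unfolding borel_separated_def by auto
    show "B n \<noteq> {}"
    proof
      assume "B n = {}"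
      then have "borel_separated (f ` A n) (g ` B n)"
        unfolding borel_separated_def by (intro bexI[of _ UNIV]) auto
      with ns show False by blast
    qed
  qed
  have anti: "A n \<subseteq> A m" "B n \<subseteq> B m" if "m \<le> n" for m n
    by (rule lift_Suc_antimono_le[OF _ that]; use Q in \<open>auto simp: Q_def A_def B_def\<close>)+
  have diam: "\<exists>n. (\<forall>x\<in>A n. \<forall>y\<in>A n. dist x y < e) \<and> (\<forall>x\<in>B n. \<forall>y\<in>B n. dist x y < e)"
    if "e > 0" for e
  proof -
    obtain n where n: "inverse (real (Suc n)) < e" using \<open>e > 0\<close> reals_Archimedean by blast
    have "(\<forall>x\<in>A (Suc n). \<forall>y\<in>A (Suc n). dist x y < e) \<and> (\<forall>x\<in>B (Suc n). \<forall>y\<in>B (Suc n). dist x y < e)"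
      using Q[of n] n unfolding Q_def A_def B_def by (meson order_le_less_trans)
    then show ?thesis by blast
  qed
  obtain p where p: "\<And>n. p \<in> A n"
    by (rule decreasing_closed_nest[OF cl(1) ne(1) anti(1)])
      (assumption, meson diam, meson)
  obtain q where q: "\<And>n. q \<in> B n"
    by (rule decreasing_closed_nest[OF cl(2) ne(2) anti(2)])
      (assumption, meson diam, meson)
  have "f p \<noteq> g q" using disj p[of 0] q[of 0] sub by blast
  then obtain U V where UV: "open U" "open V" "f p \<in> U" "g q \<in> V" "U \<inter> V = {}"
    by (metis hausdorff)
  have oU: "open (f -` U)" and oV: "open (g -` V)"
    using UV f g by (auto intro: open_vimage)
  obtain e1 where e1: "e1 > 0" "ball p e1 \<subseteq> f -` U" using oU UV(3) open_contains_ball by (metis vimageI)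
  obtain e2 where e2: "e2 > 0" "ball q e2 \<subseteq> g -` V" using oV UV(4) open_contains_ball by (metis vimageI)
  obtain n where n: "\<forall>x\<in>A n. \<forall>y\<in>A n. dist x y < min e1 e2" "\<forall>x\<in>B n. \<forall>y\<in>B n. dist x y < min e1 e2"
    using diam[of "min e1 e2"] e1 e2 by auto
  have "A n \<subseteq> ball p e1" "B n \<subseteq> ball q e2"
    using n p[of n] q[of n] by auto
  then have "f ` A n \<subseteq> U" "g ` B n \<subseteq> V" using e1 e2 by auto
  then have "borel_separated (f ` A n) (g ` B n)"
    unfolding borel_separated_def using UV by (intro bexI[of _ U]) auto
  with ns show False by blast
qed

text \<open>A Borel set separating a set from its complement is that set. The types
  \<open>'y\<close> and \<open>'z\<close> differ because non-membership will be witnessed by a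
  tuple.\<close>

lemma complementary_projections_borel:
  fixes P :: "('x::{complete_space, second_countable_topology} \<times> 'y::{complete_space, second_countable_topology}) set"
    and Q :: "('x \<times> 'z::{complete_space, second_countable_topology}) set"
  assumes "P \<in> sets borel" "Q \<in> sets borel" "fst ` Q = - (fst ` P)"
  shows "fst ` P \<in> sets borel"
proof -
  obtain F :: "(('x \<times> 'y) \<times> (nat \<Rightarrow> real)) set" where F: "closed F" "P = fst ` F"
    using borel_imp_analytic[OF assms(1)] unfolding analytic_def by blast
  obtain G :: "(('x \<times> 'z) \<times> (nat \<Rightarrow> real)) set" where G: "closed G" "Q = fst ` G"
    using borel_imp_analytic[OF assms(2)] unfolding analytic_def by blast
  have "borel_separated ((\<lambda>p. fst (fst p)) ` F) ((\<lambda>p. fst (fst p)) ` G)"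
    using assms(3) F G by (intro lusin_separation continuous_intros) (auto simp: image_image)
  then have "borel_separated (fst ` P) (- (fst ` P))"
    using assms(3) F(2) G(2) by (simp add: image_image)
  then obtain C where "C \<in> sets borel" "fst ` P \<subseteq> C" "C \<inter> - (fst ` P) = {}"
    unfolding borel_separated_def by blast
  moreover from this have "C = fst ` P" by blast
  ultimately show ?thesis by simp
qed

section \<open>Borel enumeration of finite sections\<close>

text \<open>With digits 0 and 1 in base 3, everything after place \<open>n\<close> adds at most half
  of the unit at place \<open>n\<close>, so the first difference decides. Base 2 would identify some
  distinct sequences.\<close>

lemma ternary_less:
  fixes s t :: "nat \<Rightarrow> bool"
  assumes "\<And>k. k < n \<Longrightarrow> s k = t k" "s n" "\<not> t n"
  shows "(\<Sum>k. of_bool (t k) * (1/3)^k) < (\<Sum>k. of_bool (s k) * (1/3)^k :: real)"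
proof -
  define a where "a u k = (of_bool (u k) * (1/3)^k :: real)" for u :: "nat \<Rightarrow> bool" and k
  have a: "0 \<le> a u k" "a u k \<le> (1/3)^k" for u k by (auto simp: a_def)
  have geo: "summable (\<lambda>k. (1/3)^k :: real)" by (simp add: summable_geometric)
  have sa: "summable (a u)" for u
    by (rule summable_comparison_test'[OF geo]) (use a in auto)
  have split: "suminf (a u) = (\<Sum>k. a u (k + Suc n)) + (\<Sum>k<n. a u k) + a u n" for u
    using suminf_split_initial_segment[OF sa[of u], of "Suc n"] by simp
  have "(\<Sum>k. a t (k + Suc n)) \<le> (\<Sum>k. (1/3)^(k + Suc n))"
    using geo sa by (intro suminf_le a summable_ignore_initial_segment)
  also have "\<dots> = (1/3)^(Suc n) * (\<Sum>k. (1/3)^k)"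
    by (subst suminf_mult[OF geo, symmetric]) (simp add: power_add mult.commute)
  also have "\<dots> = (1/3)^n / 2" by (subst suminf_geometric) auto
  finally have 1: "(\<Sum>k. a t (k + Suc n)) \<le> (1/3)^n / 2" .
  have 2: "0 \<le> (\<Sum>k. a s (k + Suc n))"
    by (intro suminf_nonneg a summable_ignore_initial_segment sa)
  have 3: "(\<Sum>k<n. a s k) = (\<Sum>k<n. a t k)"
    using assms(1) by (auto simp: a_def)
  have 4: "a s n = (1/3)^n" "a t n = 0" using assms(2,3) by (auto simp: a_def)
  have "(0::real) < (1/3)^n" by simp
  then have "suminf (a t) < suminf (a s)" using split[of s] split[of t] 1 2 3 4 by linarith
  then show ?thesis unfolding a_def .
qed

text \<open>A point is coded by the basic open sets that contain it. The injection later serves as a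
  linear order for choosing among finitely many points and as a measurable test of equality.\<close>

lemma ex_borel_injection:
  "\<exists>\<phi> :: 'a::{second_countable_topology, t2_space} \<Rightarrow> real. \<phi> \<in> borel_measurable borel \<and> inj \<phi>"
proof -
  obtain B :: "'a set set" where B: "countable B" "topological_basis B"
    using ex_countable_basis by blast
  have "B \<noteq> {}" using topological_basisE[OF B(2), of UNIV] by auto
  define U where "U = from_nat_into B"
  have U: "open (U n)" for n
    using B \<open>B \<noteq> {}\<close> unfolding U_def by (metis from_nat_into topological_basis_open)
  define \<phi> where "\<phi> x = (\<Sum>k. of_bool (x \<in> U k) * (1/3)^k :: real)" for x
  have "\<phi> x \<noteq> \<phi> y" if neq: "x \<noteq> y" for x y
  proof -
    obtain V W where "open V" "x \<in> V" "y \<notin> V"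
      using hausdorff[OF neq] by (metis disjoint_iff)
    then obtain b where "b \<in> B" "x \<in> b" "y \<notin> b"
      using topological_basisE[OF B(2)] by (metis subsetD)
    then have "\<exists>n. (x \<in> U n) \<noteq> (y \<in> U n)"
      using B(1) unfolding U_def by (metis from_nat_into_surj)
    then obtain n where n: "(x \<in> U n) \<noteq> (y \<in> U n)" "\<And>k. k < n \<Longrightarrow> (x \<in> U k) = (y \<in> U k)"
      using exists_least_iff[of "\<lambda>n. (x \<in> U n) \<noteq> (y \<in> U n)"] by blast
    then show ?thesis
      using ternary_less[of n "\<lambda>k. x \<in> U k" "\<lambda>k. y \<in> U k"]
        ternary_less[of n "\<lambda>k. y \<in> U k" "\<lambda>k. x \<in> U k"] unfolding \<phi>_def by (cases "x \<in> U n") auto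
  qed
  then have "inj \<phi>" by (meson injI)
  moreover have "\<phi> \<in> borel_measurable borel"
    unfolding \<phi>_def
  proof (intro borel_measurable_suminf borel_measurable_times)
    fix k
    have "(\<lambda>x. of_bool (x \<in> U k) :: real) = indicator (U k)" by (auto simp: indicator_def)
    then show "(\<lambda>x. of_bool (x \<in> U k) :: real) \<in> borel_measurable borel"
      using U by (simp add: borel_open)
  qed simp
  ultimately show ?thesis by blast
qed

text \<open>The complement of the projection is again a projection: it consists of the points whose
  section contains \<open>d\<close> distinct elements outside \<open>Q\<close>.\<close>

lemma projection_of_fixed_card_sections:
  fixes P Q :: "('x::{complete_space, second_countable_topology}
      \<times> 'y::{complete_space, second_countable_topology}) set"
  assumes P: "P \<in> sets borel" and Q: "Q \<in> sets borel"
    and fin: "\<And>x. finite {y. (x, y) \<in> P}" and card: "\<And>x. card {y. (x, y) \<in> P} = d"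
  shows "{x. \<exists>y. (x, y) \<in> P \<and> (x, y) \<in> Q} \<in> sets borel"
proof -
  \<comment> \<open>Sequences stand in for tuples of length \<open>d\<close>, since \<open>d\<close>
    is a term and not a type; entries from index \<open>d\<close> on are unconstrained.\<close>
  define R where "R = {p :: 'x \<times> (nat \<Rightarrow> 'y). (\<forall>i<d. (fst p, snd p i) \<in> P - Q) \<and>
      (\<forall>i<d. \<forall>j<i. snd p i \<noteq> snd p j)}"
  have coord: "continuous_on UNIV (\<lambda>p :: 'x \<times> (nat \<Rightarrow> 'y). snd p i)" for i
    by (rule continuous_on_product_then_coordinatewise) (intro continuous_intros)
  have "R = (\<Inter>i<d. (\<lambda>p. (fst p, snd p i)) -` (P - Q)) \<inter>
      (\<Inter>i<d. \<Inter>j<i. - {p. snd p i = snd p j})"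
    unfolding R_def by auto
  also have "\<dots> \<in> sets borel"
  proof (intro sets.Int)
    have "(\<lambda>p :: 'x \<times> (nat \<Rightarrow> 'y). (fst p, snd p i)) \<in> borel_measurable borel" for i
      by (intro borel_measurable_continuous_onI continuous_intros coord)
    from measurable_sets[OF this, of "P - Q"] P Q
    have "(\<lambda>p :: 'x \<times> (nat \<Rightarrow> 'y). (fst p, snd p i)) -` (P - Q) \<in> sets borel" for i by simp
    then show "(\<Inter>i<d. (\<lambda>p. (fst p, snd p i)) -` (P - Q)) \<in> sets borel"
      by (intro sets.countable_INT'') auto
    have "closed {p :: 'x \<times> (nat \<Rightarrow> 'y). snd p i = snd p j}" for i j
      by (intro closed_Collect_eq coord)
    then show "(\<Inter>i<d. \<Inter>j<i. - {p :: 'x \<times> (nat \<Rightarrow> 'y). snd p i = snd p j}) \<in> sets borel"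
      by (intro sets.countable_INT'' borel_comp borel_closed) auto
  qed
  finally have R: "R \<in> sets borel" .
  have "fst ` R = - (fst ` (P \<inter> Q))"
  proof (intro equalityI subsetI)
    fix x assume "x \<in> fst ` R"
    then obtain z where z: "\<And>i. i < d \<Longrightarrow> (x, z i) \<in> P - Q"
      "\<And>i j. i < d \<Longrightarrow> j < i \<Longrightarrow> z i \<noteq> z j" unfolding R_def by auto
    have inj: "inj_on z {..<d}" using z(2) by (intro linorder_inj_onI) (auto, metis)
    have zP: "z ` {..<d} = {y. (x, y) \<in> P}"
      using z(1) fin card inj by (intro card_subset_eq) (auto simp: card_image)
    have "(x, y) \<notin> Q" if "(x, y) \<in> P" for y
    proof -
      have "y \<in> z ` {..<d}" using that zP by simp
      then show ?thesis using z(1) by auto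
    qed
    then show "x \<in> - (fst ` (P \<inter> Q))" by force
  next
    fix x assume x: "x \<in> - (fst ` (P \<inter> Q))"
    obtain z where z: "bij_betw z {0..<d} {y. (x, y) \<in> P}"
      using ex_bij_betw_nat_finite[OF fin[of x]] card by auto
    have "(x, z i) \<in> P - Q" if "i < d" for i
    proof -
      have "(x, z i) \<in> P" using bij_betwE[OF z] that by auto
      then show ?thesis using x by force
    qed
    moreover have "z i \<noteq> z j" if "i < d" "j < i" for i j
      using inj_onD[OF bij_betw_imp_inj_on[OF z], of i j] that by auto
    ultimately have "(x, z) \<in> R" unfolding R_def by auto
    then show "x \<in> fst ` R" by force
  qed
  then have "fst ` (P \<inter> Q) \<in> sets borel"
    using R P Q by (intro complementary_projections_borel[of "P \<inter> Q" R]) auto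
  moreover have "fst ` (P \<inter> Q) = {x. \<exists>y. (x, y) \<in> P \<and> (x, y) \<in> Q}" by force
  ultimately show ?thesis by simp
qed

text \<open>Deleting the element of least \<open>\<phi>\<close>-value lowers every section size by
  one. The minimum \<open>m\<close> is Borel because its strict sublevel sets are projections, and
  the minimiser \<open>g\<close> because its graph has sections of size 1.\<close>

lemma borel_enumeration_of_sections:
  fixes P :: "('x::{complete_space, second_countable_topology}
      \<times> 'y::{complete_space, second_countable_topology}) set"
  assumes "P \<in> sets borel"
    and "\<And>x. finite {y. (x, y) \<in> P}" and "\<And>x. card {y. (x, y) \<in> P} = d"
  shows "\<exists>h :: nat \<Rightarrow> 'x \<Rightarrow> 'y. (\<forall>i<d. h i \<in> borel_measurable borel) \<and>
    (\<forall>x. inj_on (\<lambda>i. h i x) {..<d} \<and> {y. (x, y) \<in> P} = (\<lambda>i. h i x) ` {..<d})"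
  using assms
proof (induction d arbitrary: P)
  case 0
  then show ?case by auto
next
  case (Suc d)
  note P = Suc.prems(1) and fin = Suc.prems(2) and card = Suc.prems(3)
  obtain \<phi> :: "'y \<Rightarrow> real" where \<phi>: "\<phi> \<in> borel_measurable borel" "inj \<phi>"
    using ex_borel_injection by blast
  have fs: "fst \<in> borel_measurable (borel :: ('x \<times> 'y) measure)"
    "snd \<in> borel_measurable (borel :: ('x \<times> 'y) measure)"
    by (intro borel_measurable_continuous_onI continuous_intros)+
  define m where "m x = Min (\<phi> ` {y. (x, y) \<in> P})" for x
  have ne: "{y. (x, y) \<in> P} \<noteq> {}" for x using card[of x] by (metis card.empty nat.distinct(1))
  have "m \<in> borel_measurable borel"
    unfolding borel_measurable_iff_less
  proof
    fix c
    have "\<phi> -` {..<c} \<in> sets borel" using measurable_sets[OF \<phi>(1), of "{..<c}"] by simp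
    then have "snd -` (\<phi> -` {..<c}) \<in> sets (borel :: ('x \<times> 'y) measure)"
      using measurable_sets[OF fs(2)] by force
    from projection_of_fixed_card_sections[OF P this fin card]
    have "{x. \<exists>y. (x, y) \<in> P \<and> \<phi> y < c} \<in> sets borel" by simp
    moreover have "{x. \<exists>y. (x, y) \<in> P \<and> \<phi> y < c} = {x. m x < c}"
      unfolding m_def using fin ne by (subst Min_less_iff) auto
    ultimately show "{w \<in> space borel. m w < c} \<in> sets borel" by simp
  qed
  define G where "G = {p \<in> P. \<phi> (snd p) = m (fst p)}"
  have "{p \<in> space borel. \<phi> (snd p) = m (fst p)} \<in> sets (borel :: ('x \<times> 'y) measure)"
    using \<open>m \<in> borel_measurable borel\<close> \<phi>(1) fs
    by (intro borel_measurable_eq measurable_compose[OF fs(2)] measurable_compose[OF fs(1)])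
  then have "P \<inter> {p \<in> space borel. \<phi> (snd p) = m (fst p)} \<in> sets borel" using P by auto
  then have G: "G \<in> sets borel" unfolding G_def by (simp add: Int_def)
  have "\<exists>y. {y. (x, y) \<in> G} = {y}" for x
  proof -
    have "m x \<in> \<phi> ` {y. (x, y) \<in> P}" unfolding m_def using fin ne by (intro Min_in) auto
    then obtain y where y: "(x, y) \<in> P" "\<phi> y = m x" by auto
    then have "z = y" if "(x, z) \<in> G" for z
      using that unfolding G_def by (auto intro: injD[OF \<phi>(2)])
    moreover have "(x, y) \<in> G" unfolding G_def using y by simp
    ultimately have "{y. (x, y) \<in> G} = {y}" by blast
    then show ?thesis by blast
  qed
  then obtain g where g: "\<And>x. {y. (x, y) \<in> G} = {g x}" by metis
  have gG: "(x, y) \<in> G \<longleftrightarrow> y = g x" for x y using g[of x] by (simp add: set_eq_iff)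
  have gP: "(x, g x) \<in> P" for x using gG[of x] unfolding G_def by blast
  have g_meas: "g \<in> borel_measurable borel"
  proof (rule measurableI)
    fix B :: "'y set" assume "B \<in> sets borel"
    then have "snd -` B \<in> sets (borel :: ('x \<times> 'y) measure)"
      using measurable_sets[OF fs(2)] by force
    from projection_of_fixed_card_sections[OF G this, of 1]
    have "{x. \<exists>y. (x, y) \<in> G \<and> y \<in> B} \<in> sets borel" by (simp add: g)
    moreover have "{x. \<exists>y. (x, y) \<in> G \<and> y \<in> B} = g -` B" using gG by auto
    ultimately show "g -` B \<inter> space borel \<in> sets borel" by simp
  qed simp
  have sec: "{y. (x, y) \<in> P - G} = {y. (x, y) \<in> P} - {g x}" for x using gG by auto
  have "\<exists>h. (\<forall>i<d. h i \<in> borel_measurable borel) \<and>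
      (\<forall>x. inj_on (\<lambda>i. h i x) {..<d} \<and> {y. (x, y) \<in> P - G} = (\<lambda>i. h i x) ` {..<d})"
  proof (rule Suc.IH)
    show "P - G \<in> sets borel" using P G by auto
    show "finite {y. (x, y) \<in> P - G}" for x unfolding sec using fin by auto
    show "card {y. (x, y) \<in> P - G} = d" for x unfolding sec using card[of x] gP[of x] by simp
  qed
  then obtain h where h: "\<And>i. i < d \<Longrightarrow> h i \<in> borel_measurable borel"
    "\<And>x. inj_on (\<lambda>i. h i x) {..<d}"
    "\<And>x. {y. (x, y) \<in> P} - {g x} = (\<lambda>i. h i x) ` {..<d}" unfolding sec by blast
  define h' where "h' i = (if i = d then g else h i)" for i
  have "h' i \<in> borel_measurable borel" if "i < Suc d" for i
    using that h(1) g_meas unfolding h'_def by auto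
  moreover have im: "(\<lambda>i. h' i x) ` {..<d} = {y. (x, y) \<in> P} - {g x}" for x
    unfolding h(3) by (rule image_cong) (auto simp: h'_def)
  moreover have "inj_on (\<lambda>i. h' i x) {..<d}" for x
    using h(2)[of x] by (rule inj_on_cong[THEN iffD1, rotated]) (auto simp: h'_def)
  moreover have "h' d x = g x" for x by (simp add: h'_def)
  ultimately have "\<forall>x. inj_on (\<lambda>i. h' i x) {..<Suc d} \<and> {y. (x, y) \<in> P} = (\<lambda>i. h' i x) ` {..<Suc d}"
    using gP by (auto simp: lessThan_Suc)
  then show ?case using \<open>\<And>i. i < Suc d \<Longrightarrow> h' i \<in> borel_measurable borel\<close> by blast
qed

section \<open>Almost alternating two-colourings for two involutions\<close>

lemma card_le_1I: "(\<And>x y. x \<in> A \<Longrightarrow> y \<in> A \<Longrightarrow> x = y) \<Longrightarrow> card A \<le> 1"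
  by (metis card.empty card.infinite card_le_Suc0_iff_eq One_nat_def zero_le_one)

locale free_involutions =
  fixes M :: "'d measure" and a b :: "'d \<Rightarrow> 'd" and \<phi> :: "'d \<Rightarrow> real"
  assumes space_UNIV: "space M = UNIV"
    and a_meas [measurable]: "a \<in> measurable M M" and b_meas [measurable]: "b \<in> measurable M M"
    and a_a [simp]: "a (a x) = x" and b_b [simp]: "b (b x) = x"
    and a_free: "a x \<noteq> x" and b_free: "b x \<noteq> x"
    and \<phi>_meas [measurable]: "\<phi> \<in> borel_measurable M" and \<phi>_inj: "inj \<phi>"
begin

definition shift :: "int \<Rightarrow> 'd \<Rightarrow> 'd" where
  "shift k = (if 0 \<le> k then (a \<circ> b) ^^ nat k else (b \<circ> a) ^^ nat (- k))"

lemma shift_0 [simp]: "shift 0 x = x"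
  by (simp add: shift_def)

lemma shift_succ: "shift (k + 1) x = a (b (shift k x))"
proof (cases "0 \<le> k")
  case True
  then show ?thesis by (simp add: shift_def nat_add_distrib)
next
  case False
  then have "nat (- k) = Suc (nat (- (k + 1)))" by simp
  moreover have "shift (k + 1) x = ((b \<circ> a) ^^ nat (- (k + 1))) x"
    using False by (cases "k + 1 = 0") (auto simp: shift_def)
  ultimately show ?thesis using False by (simp add: shift_def)
qed

lemma shift_pred: "shift (k - 1) x = b (a (shift k x))"
  using shift_succ[of "k - 1" x] by simp

lemma shift_add: "shift (k + l) x = shift k (shift l x)"
proof (induction k rule: int_induct[where k = 0])
  case (step1 i)
  then show ?case using shift_succ[of "i + l" x] shift_succ[of i "shift l x"] by (simp add: algebra_simps)
next
  case (step2 i)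
  then show ?case using shift_pred[of "i + l" x] shift_pred[of i "shift l x"] by (simp add: algebra_simps)
qed simp

lemma a_shift: "a (shift k x) = shift (- k) (a x)"
proof (induction k rule: int_induct[where k = 0])
  case (step1 i)
  have "shift (- i - 1) (a x) = b (a (a (shift i x)))" by (simp only: shift_pred step1)
  then show ?case by (simp add: shift_succ)
next
  case (step2 i)
  have "a (shift (i - 1) x) = a (b (a (shift i x)))" by (simp add: shift_pred)
  also have "\<dots> = shift (- i + 1) (a x)" by (simp only: step2 shift_succ)
  finally show ?case by simp
qed simp

lemma shift_cancel [simp]: "shift (- k) (shift k x) = x"
  using shift_add[of "- k" k x] by simp

text \<open>In the dihedral group, \<open>a\<close> composed with \<open>shift m\<close> is a
  conjugate of \<open>a\<close> for even \<open>m\<close> and of \<open>b\<close> for odd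
  \<open>m\<close>, hence fixes no point. So \<open>a\<close> exchanges two disjoint
  \<open>shift\<close>-orbits, and alternating colours means selecting one of them.\<close>

lemma a_not_in_shift_orbit: "shift m x \<noteq> a x"
proof
  assume m: "shift m x = a x"
  define l where "l = m div 2"
  have *: "a (shift l x) = shift (m - l) x"
    using a_shift[of l x] shift_add[of "- l" m x] m by simp
  consider "m = 2 * l" | "m = 2 * l + 1" unfolding l_def by linarith
  then show False
  proof cases
    case 1
    then show False using * a_free[of "shift l x"] by simp
  next
    case 2
    then have "a (shift l x) = a (b (shift l x))" using * shift_succ[of l x] by (simp add: add.commute)
    then show False using b_free[of "shift l x"] by (metis a_a)
  qed
qed

lemma shift_meas [measurable]: "shift k \<in> measurable M M"
proof -
  have "(f ^^ n) \<in> measurable M M" if "f \<in> measurable M M" for f n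
    using that by (induction n) (auto intro: measurable_comp)
  then show ?thesis unfolding shift_def by (auto intro: measurable_comp a_meas b_meas)
qed

section \<open>Borel markers along the orbits\<close>

definition box :: "nat \<Rightarrow> 'd set" where
  "box n = (case from_nat n of (p, q) \<Rightarrow> {x. real_of_rat p < \<phi> x \<and> \<phi> x < real_of_rat q})"

lemma box_sets [measurable]: "box n \<in> sets M"
proof -
  have "{x \<in> space M. real_of_rat p < \<phi> x \<and> \<phi> x < real_of_rat q} \<in> sets M" for p q by measurable
  then show ?thesis unfolding box_def by (simp add: space_UNIV split: prod.split)
qed

text \<open>Rational intervals in the \<open>\<phi>\<close>-coordinate give a countable family of
  test sets; being countable, they can drive a greedy construction in stages.\<close>

lemma box_isolates:
  assumes "finite Y"
  shows "\<exists>n. x \<in> box n \<and> (\<forall>y\<in>Y. y \<noteq> x \<longrightarrow> y \<notin> box n)"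
proof -
  obtain e where e: "e > 0" "\<And>r. r \<in> \<phi> ` Y \<Longrightarrow> r \<noteq> \<phi> x \<Longrightarrow> e \<le> dist (\<phi> x) r"
    using finite_set_avoid[of "\<phi> ` Y" "\<phi> x"] assms by blast
  obtain p where p: "\<phi> x - e < real_of_rat p" "real_of_rat p < \<phi> x"
    using of_rat_dense[of "\<phi> x - e" "\<phi> x"] e by auto
  obtain q where q: "\<phi> x < real_of_rat q" "real_of_rat q < \<phi> x + e"
    using of_rat_dense[of "\<phi> x" "\<phi> x + e"] e by auto
  have box: "box (to_nat (p, q)) = {y. real_of_rat p < \<phi> y \<and> \<phi> y < real_of_rat q}"
    by (simp add: box_def)
  have "y \<notin> box (to_nat (p, q))" if "y \<in> Y" "y \<noteq> x" for y
  proof -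
    have "\<phi> y \<noteq> \<phi> x" using that \<phi>_inj by (meson injD)
    then have "e \<le> \<bar>\<phi> x - \<phi> y\<bar>" using e(2)[of "\<phi> y"] that by (simp add: dist_real_def)
    then show ?thesis unfolding box using p q by auto
  qed
  then show ?thesis using box p q by (intro exI[of _ "to_nat (p, q)"]) auto
qed

text \<open>Greedy construction of a maximal set with distinct points more than \<open>K\<close>
  steps apart. All eligible points of \<open>box n\<close> enter together, which is safe because
  points that meet another point of the box within reach are skipped. The test
  \<open>shift k x \<noteq> x\<close> allows for finite orbits.\<close>

primrec stage :: "nat \<Rightarrow> nat \<Rightarrow> 'd set" where
  "stage K 0 = {}"
| "stage K (Suc n) = stage K n \<union> {x \<in> box n. \<forall>k\<in>{- int K..int K}.
     shift k x \<notin> stage K n \<and> (shift k x \<noteq> x \<longrightarrow> shift k x \<notin> box n)}"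

definition markers :: "nat \<Rightarrow> 'd set" where
  "markers K = (\<Union>n. stage K n)"

lemma stage_sets [measurable]: "stage K n \<in> sets M"
proof (induction n)
  case (Suc n)
  note Suc [measurable]
  \<comment> \<open>Points are compared through \<open>\<phi>\<close>, since the diagonal of
    \<open>M\<close> is not assumed measurable.\<close>
  have "{x \<in> space M. x \<in> box n \<and> (\<forall>k\<in>{- int K..int K}.
     shift k x \<notin> stage K n \<and> (\<phi> (shift k x) \<noteq> \<phi> x \<longrightarrow> shift k x \<notin> box n))} \<in> sets M"
    by measurable
  then show ?case using Suc \<phi>_inj by (auto simp: space_UNIV inj_eq)
qed simp

lemma markers_sets [measurable]: "markers K \<in> sets M"
  unfolding markers_def by measurable

text \<open>Of two distinct points within reach, an earlier one blocks the later one, and two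
  entering together would share a box. The conclusion is equality of points rather than
  \<open>k = 0\<close> because orbits may be finite.\<close>

lemma markers_discrete:
  assumes "x \<in> markers K" "shift k x \<in> markers K" "\<bar>k\<bar> \<le> int K"
  shows "shift k x = x"
proof -
  have "shift k x = x" if "x \<in> stage K n" "shift k x \<in> stage K n" for n
    using that
  proof (induction n)
    case (Suc n)
    have *: "k \<in> {- int K..int K}" "- k \<in> {- int K..int K}" using assms(3) by auto
    consider "x \<in> stage K n" "shift k x \<in> stage K n"
      | "x \<in> stage K n" "shift k x \<notin> stage K n"
      | "x \<notin> stage K n" "shift k x \<in> stage K n"
      | "x \<notin> stage K n" "shift k x \<notin> stage K n" by blast
    then show ?case
    proof cases
      case 1
      then show ?thesis using Suc.IH by simp
    next
      case 2
      then have "\<forall>j\<in>{- int K..int K}. shift j (shift k x) \<notin> stage K n" using Suc.prems(2) by simp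
      with *(2) have "shift (- k) (shift k x) \<notin> stage K n" by blast
      with 2 show ?thesis by simp
    next
      case 3
      then show ?thesis using Suc.prems(1) *(1) by auto
    next
      case 4
      then show ?thesis using Suc.prems *(1) by auto
    qed
  qed simp
  moreover obtain n m where "x \<in> stage K n" "shift k x \<in> stage K m"
    using assms unfolding markers_def by auto
  moreover have "stage K n \<subseteq> stage K (max n m)" "stage K m \<subseteq> stage K (max n m)" for n m
    by (rule lift_Suc_mono_le; auto)+
  ultimately show ?thesis by blast
qed

text \<open>At the stage of a box that isolates \<open>x\<close> from the points within reach, only
  an earlier marker within reach can keep \<open>x\<close> out.\<close>

lemma markers_syndetic: "\<exists>k\<in>{- int K..int K}. shift k x \<in> markers K"
proof -
  obtain n where n: "x \<in> box n" "\<And>k. k \<in> {- int K..int K} \<Longrightarrow> shift k x \<noteq> x \<Longrightarrow> shift k x \<notin> box n"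
    using box_isolates[of "(\<lambda>k. shift k x) ` {- int K..int K}" x] by auto
  show ?thesis
  proof (cases "\<exists>k\<in>{- int K..int K}. shift k x \<in> stage K n")
    case True
    then show ?thesis unfolding markers_def by blast
  next
    case False
    then have "shift 0 x \<in> stage K (Suc n)" using n by simp
    then have "shift 0 x \<in> markers K" unfolding markers_def by blast
    then show ?thesis by force
  qed
qed

text \<open>Since markers are rare, moving a window by one step changes the set of markers in it for
  only boundedly many of its \<open>K\<close> possible lengths. Comparing the largest label near \<open>x\<close> with the
  largest label near \<open>a x\<close> therefore selects one side of the orbit almost consistently.\<close>

definition label :: "nat \<Rightarrow> 'd \<Rightarrow> real" where
  "label K x = (if x \<in> markers K then exp (\<phi> x) else 0)"

definition window_max :: "nat \<Rightarrow> int \<Rightarrow> 'd \<Rightarrow> real" where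
  "window_max K n x = Max ((\<lambda>k. label K (shift k x)) ` {- n..n})"

lemma window_max_meas [measurable]: "window_max K n \<in> borel_measurable M"
  unfolding window_max_def label_def by measurable

text \<open>A window of radius at least \<open>K\<close> contains a marker, and \<open>exp\<close>
  makes marker labels positive while all other points have label 0. The maximum thus belongs to an
  actual marker.\<close>

lemma window_max_attained:
  assumes "int K \<le> n"
  shows "\<exists>k. shift k x \<in> markers K \<and> window_max K n x = exp (\<phi> (shift k x))"
proof -
  obtain j where j: "j \<in> {- int K..int K}" "shift j x \<in> markers K" using markers_syndetic by blast
  have "label K (shift j x) \<le> window_max K n x"
    unfolding window_max_def using j assms by (intro Max_ge) auto
  moreover have "label K (shift j x) > 0" using j by (simp add: label_def)
  moreover have "window_max K n x \<in> (\<lambda>k. label K (shift k x)) ` {- n..n}"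
    unfolding window_max_def using assms by (intro Max_in) auto
  ultimately obtain k where "window_max K n x = label K (shift k x)" "label K (shift k x) > 0" by auto
  then show ?thesis unfolding label_def by (intro exI[of _ k]) (auto split: if_splits)
qed

text \<open>Equal maxima would, by injectivity of \<open>\<phi>\<close>, come from one marker lying
  in both of two disjoint \<open>shift\<close>-orbits.\<close>

lemma window_max_a_neq:
  assumes "int K \<le> n"
  shows "window_max K n (a x) \<noteq> window_max K n x"
proof
  assume eq: "window_max K n (a x) = window_max K n x"
  obtain k l where "window_max K n x = exp (\<phi> (shift k x))" "window_max K n (a x) = exp (\<phi> (shift l (a x)))"
    using window_max_attained[OF assms] by metis
  then have "shift k x = shift l (a x)" using eq \<phi>_inj by (simp add: inj_eq)
  then have "shift (- l) (shift k x) = a x" by simp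
  then have "shift (- l + k) x = a x" by (simp only: shift_add)
  then show False using a_not_in_shift_orbit by blast
qed

section \<open>Effect of moving a window by one step\<close>

definition enters_right :: "nat \<Rightarrow> 'd \<Rightarrow> int \<Rightarrow> bool" where
  "enters_right K x n \<longleftrightarrow> shift (n + 1) x \<in> markers K \<and> (\<forall>k\<in>{- n..n}. shift k x \<noteq> shift (n + 1) x)"

definition leaves_left :: "nat \<Rightarrow> 'd \<Rightarrow> int \<Rightarrow> bool" where
  "leaves_left K x n \<longleftrightarrow> shift (- n) x \<in> markers K \<and> (\<forall>k\<in>{- n + 1..n + 1}. shift k x \<noteq> shift (- n) x)"

text \<open>The window of \<open>a (b x)\<close> is that of \<open>x\<close> moved by one: index
  \<open>n + 1\<close> enters and \<open>- n\<close> leaves. This affects the maximum only if the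
  point concerned is a marker that the other window does not already contain at another index, as
  may happen on a short cycle.\<close>

lemma window_max_changes:
  assumes "0 \<le> n" "window_max K n (a (b x)) \<noteq> window_max K n x"
  shows "enters_right K x n \<or> leaves_left K x n"
proof (rule ccontr)
  assume "\<not> ?thesis"
  then have r: "shift (n + 1) x \<in> markers K \<Longrightarrow> \<exists>k\<in>{- n..n}. shift k x = shift (n + 1) x"
    and l: "shift (- n) x \<in> markers K \<Longrightarrow> \<exists>k\<in>{- n + 1..n + 1}. shift k x = shift (- n) x"
    unfolding enters_right_def leaves_left_def by auto
  have T: "shift k (a (b x)) = shift (k + 1) x" for k
    using shift_add[of k 1 x] shift_succ[of 0 x] by simp
  have ge: "label K (shift k y) \<le> window_max K n y" if "k \<in> {- n..n}" for k y
    unfolding window_max_def using that by (intro Max_ge) auto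
  have ge0: "0 \<le> window_max K n y" for y
    using ge[of 0 y] assms(1) by (auto simp: label_def split: if_splits intro: order_trans[OF exp_ge_zero])
  have geT: "label K (shift k x) \<le> window_max K n (a (b x))" if "k \<in> {- n + 1..n + 1}" for k
    using ge[of "k - 1" "a (b x)"] that by (auto simp: T)
  have ne: "(\<lambda>k. label K (shift k y)) ` {- n..n} \<noteq> {}" for y using assms(1) by auto
  have "window_max K n x \<le> window_max K n (a (b x))"
    unfolding window_max_def[of K n x]
  proof (intro Max.boundedI ne)
    fix v assume "v \<in> (\<lambda>k. label K (shift k x)) ` {- n..n}"
    then obtain k where k: "k \<in> {- n..n}" "v = label K (shift k x)" by auto
    show "v \<le> window_max K n (a (b x))"
    proof (cases "k = - n")
      case False
      then show ?thesis using geT[of k] k by auto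
    next
      case True
      show ?thesis
      proof (cases "shift k x \<in> markers K")
        case True
        then obtain j where "j \<in> {- n + 1..n + 1}" "shift j x = shift k x" using l \<open>k = - n\<close> by auto
        then show ?thesis using geT[of j] k by simp
      qed (use k ge0 in \<open>simp add: label_def\<close>)
    qed
  qed simp
  moreover have "window_max K n (a (b x)) \<le> window_max K n x"
    unfolding window_max_def[of K n "a (b x)"]
  proof (intro Max.boundedI ne)
    fix v assume "v \<in> (\<lambda>k. label K (shift k (a (b x)))) ` {- n..n}"
    then obtain k where k: "k \<in> {- n..n}" "v = label K (shift (k + 1) x)" by (auto simp: T)
    show "v \<le> window_max K n x"
    proof (cases "k = n")
      case False
      then show ?thesis using ge[of "k + 1" x] k by auto
    next
      case True
      show ?thesis
      proof (cases "shift (k + 1) x \<in> markers K")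
        case True
        then obtain j where "j \<in> {- n..n}" "shift j x = shift (k + 1) x" using r \<open>k = n\<close> by auto
        then show ?thesis using ge[of j x] k by simp
      qed (use k ge0 in \<open>simp add: label_def\<close>)
    qed
  qed simp
  ultimately show False using assms(2) by simp
qed

text \<open>Two such radii differ by less than \<open>K\<close>, so the two entering markers
  coincide by discreteness; but the first one already lies in the longer window.\<close>

lemma card_enters_right: "card {i. i < K \<and> enters_right K x (int (K + i))} \<le> 1"
proof -
  have False if "i < j" "j < K" "enters_right K x (int (K + i))" "enters_right K x (int (K + j))" for i j
  proof -
    have *: "shift (int (j - i)) (shift (int (K + i) + 1) x) = shift (int (K + j) + 1) x"
      using that(1) by (simp add: shift_add[symmetric] of_nat_diff algebra_simps)
    then have "shift (int (K + j) + 1) x = shift (int (K + i) + 1) x"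
      using markers_discrete[of "shift (int (K + i) + 1) x" K "int (j - i)"] that
      unfolding enters_right_def by auto
    then show False using that unfolding enters_right_def by fastforce
  qed
  then show ?thesis by (intro card_le_1I) (metis (mono_tags, lifting) mem_Collect_eq nat_neq_iff)
qed

lemma card_leaves_left: "card {i. i < K \<and> leaves_left K x (int (K + i))} \<le> 1"
proof -
  have False if "i < j" "j < K" "leaves_left K x (int (K + i))" "leaves_left K x (int (K + j))" for i j
  proof -
    have *: "shift (- int (j - i)) (shift (- int (K + i)) x) = shift (- int (K + j)) x"
      using that(1) by (simp add: shift_add[symmetric] of_nat_diff algebra_simps)
    then have "shift (- int (K + j)) x = shift (- int (K + i)) x"
      using markers_discrete[of "shift (- int (K + i)) x" K "- int (j - i)"] that
      unfolding leaves_left_def by auto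
    then show False using that unfolding leaves_left_def by fastforce
  qed
  then show ?thesis by (intro card_le_1I) (metis (mono_tags, lifting) mem_Collect_eq nat_neq_iff)
qed

lemma almost_alternating:
  "\<exists>f :: nat \<Rightarrow> 'd \<Rightarrow> bool. (\<forall>i. f i \<in> measurable M (count_space UNIV)) \<and>
     (\<forall>i x. f i (a x) \<noteq> f i x) \<and> (\<forall>x. card {i. i < K \<and> f i (b x) = f i x} \<le> 4)"
proof -
  \<comment> \<open>The radii \<open>K + i\<close> are at least \<open>K\<close>, so both windows
    see a marker and the comparison is never a tie.\<close>
  define f where "f i x \<longleftrightarrow> window_max K (int (K + i)) (a x) < window_max K (int (K + i)) x" for i x
  have "f i \<in> measurable M (count_space UNIV)" for i unfolding f_def by measurable
  moreover have fa: "f i (a x) \<noteq> f i x" for i x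
    using window_max_a_neq[of K "int (K + i)" x] unfolding f_def by auto
  moreover have "card {i. i < K \<and> f i (b x) = f i x} \<le> 4" for x
  proof -
    define R where "R y = {i. i < K \<and> enters_right K y (int (K + i))}" for y
    define L where "L y = {i. i < K \<and> leaves_left K y (int (K + i))}" for y
    have "{i. i < K \<and> f i (b x) = f i x} \<subseteq> (R x \<union> L x) \<union> (R (b x) \<union> L (b x))"
    proof
      fix i assume "i \<in> {i. i < K \<and> f i (b x) = f i x}"
      then have i: "i < K" "f i (b x) = f i x" by auto
      then have "f i (a (b x)) \<noteq> f i x" using fa[of i "b x"] by simp
      \<comment> \<open>As \<open>a\<close> always changes the colour, failure at \<open>b\<close>
        means that \<open>a \<circ> b\<close> changes it. Since \<open>a x = a (b (b x))\<close>,
        this forces a window change at \<open>x\<close> or at \<open>b x\<close>; two kinds of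
        change at two points give the bound 4.\<close>
      then have "window_max K (int (K + i)) (a (b x)) \<noteq> window_max K (int (K + i)) x \<or>
          window_max K (int (K + i)) (b x) \<noteq> window_max K (int (K + i)) (a (b (b x)))"
        unfolding f_def by auto
      then show "i \<in> (R x \<union> L x) \<union> (R (b x) \<union> L (b x))"
        using window_max_changes[of "int (K + i)" K x] window_max_changes[of "int (K + i)" K "b x"] i(1)
        unfolding R_def L_def by auto
    qed
    then have "card {i. i < K \<and> f i (b x) = f i x} \<le> card ((R x \<union> L x) \<union> (R (b x) \<union> L (b x)))"
      by (intro card_mono) (auto simp: R_def L_def)
    also have "\<dots> \<le> (card (R x) + card (L x)) + (card (R (b x)) + card (L (b x)))"
      by (meson add_mono card_Un_le order_trans)
    also have "\<dots> \<le> 4"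
      using card_enters_right[of K x] card_leaves_left[of K x]
        card_enters_right[of K "b x"] card_leaves_left[of K "b x"]
      unfolding R_def L_def by linarith
    finally show ?thesis .
  qed
  ultimately show ?thesis by blast
qed

end

lemma ex_injection_times_bool:
  assumes [measurable]: "\<phi> \<in> borel_measurable M" and inj: "inj (\<phi> :: 'd \<Rightarrow> real)"
  shows "\<exists>\<psi> :: 'd \<times> bool \<Rightarrow> real. \<psi> \<in> borel_measurable (M \<Otimes>\<^sub>M count_space UNIV) \<and> inj \<psi>"
proof (intro exI conjI)
  \<comment> \<open>The values of \<open>arctan\<close> fill an interval of length pi, less than 10,
    so the two copies have disjoint images.\<close>
  define \<psi> where "\<psi> p = arctan (\<phi> (fst p)) + (if snd p then 10 else 0)" for p :: "'d \<times> bool"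
  show "\<psi> \<in> borel_measurable (M \<Otimes>\<^sub>M count_space UNIV)" unfolding \<psi>_def by measurable
  have "p = q" if "\<psi> p = \<psi> q" for p q
  proof -
    have "snd p = snd q" "arctan (\<phi> (fst p)) = arctan (\<phi> (fst q))"
      using that arctan_bounded[of "\<phi> (fst p)"] arctan_bounded[of "\<phi> (fst q)"] pi_less_4
      unfolding \<psi>_def by (auto split: if_splits)
    then show ?thesis using inj by (simp add: prod_eq_iff inj_eq arctan_eq_iff)
  qed
  then show "inj \<psi>" by (rule injI)
qed

text \<open>Fixed points are removed by passing to two copies and swapping the copies there.\<close>

lemma involutions_almost_alternating:
  fixes M :: "'d measure" and a b :: "'d \<Rightarrow> 'd" and \<phi> :: "'d \<Rightarrow> real"
  assumes "space M = UNIV"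
    and [measurable]: "a \<in> measurable M M" "b \<in> measurable M M" "\<phi> \<in> borel_measurable M"
    and a_a: "\<And>x. a (a x) = x" and b_b: "\<And>x. b (b x) = x" and inj: "inj \<phi>"
  shows "\<exists>f :: nat \<Rightarrow> 'd \<Rightarrow> bool. (\<forall>i. f i \<in> measurable M (count_space UNIV)) \<and>
     (\<forall>i x. a x \<noteq> x \<longrightarrow> f i (a x) \<noteq> f i x) \<and>
     (\<forall>x. b x \<noteq> x \<longrightarrow> card {i. i < K \<and> f i (b x) = f i x} \<le> 4)"
proof -
  define N where "N = M \<Otimes>\<^sub>M count_space (UNIV :: bool set)"
  define lift where "lift c p = (if c (fst p) = fst p then (fst p, \<not> snd p) else (c (fst p), snd p))"
    for c :: "'d \<Rightarrow> 'd" and p :: "'d \<times> bool"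
  obtain \<psi> :: "'d \<times> bool \<Rightarrow> real" where \<psi>: "\<psi> \<in> borel_measurable N" "inj \<psi>"
    using ex_injection_times_bool[of \<phi> M] inj unfolding N_def by auto
  have fix_iff: "c x = x \<longleftrightarrow> \<phi> (c x) = \<phi> x" for c x using inj by (simp add: inj_eq)
  have lift: "lift c \<in> measurable N N" if [measurable]: "c \<in> measurable M M" for c
    unfolding lift_def N_def fix_iff by measurable
  have invol: "lift c (lift c p) = p" if "\<And>x. c (c x) = x" for c p
    unfolding lift_def using that by (auto simp: prod_eq_iff)
  have free: "lift c p \<noteq> p" for c p unfolding lift_def by (auto simp: prod_eq_iff)
  interpret free_involutions N "lift a" "lift b" \<psi>
    by unfold_locales
      (use assms lift invol free \<psi> in \<open>auto simp: N_def space_pair_measure\<close>)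
  obtain f :: "nat \<Rightarrow> 'd \<times> bool \<Rightarrow> bool" where f: "\<forall>i. f i \<in> measurable N (count_space UNIV)" "\<forall>i p. f i (lift a p) \<noteq> f i p"
    "\<forall>p. card {i. i < K \<and> f i (lift b p) = f i p} \<le> 4" using almost_alternating[of K] by blast
  \<comment> \<open>On the copy \<open>True\<close>, the lift of an involution agrees with it away
    from its fixed points, which the conclusion excludes.\<close>
  define g where "g i x = f i (x, True)" for i x
  have "g i \<in> measurable M (count_space UNIV)" for i
    unfolding g_def by (rule measurable_compose[OF _ f(1)[rule_format]]) (simp add: N_def)
  moreover have "g i (a x) \<noteq> g i x" if "a x \<noteq> x" for i x
    using f(2)[rule_format, of i "(x, True)"] that by (simp add: g_def lift_def)
  moreover have "card {i. i < K \<and> g i (b x) = g i x} \<le> 4" if "b x \<noteq> x" for x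
    using f(3)[rule_format, of "(x, True)"] that by (simp add: g_def lift_def)
  ultimately show ?thesis by blast
qed

section \<open>Pairing edge ends\<close>

lemma ex_pairing:
  fixes A :: "'i set"
  assumes "finite A"
  shows "\<exists>\<pi>. (\<forall>i. \<pi> (\<pi> i) = i) \<and> (\<forall>i\<in>A. \<pi> i \<in> A) \<and> (even (card A) \<longrightarrow> (\<forall>i\<in>A. \<pi> i \<noteq> i))"
  using assms
proof (induction "card A" arbitrary: A rule: less_induct)
  case less
  show ?case
  proof (cases "card A \<le> 1")
    case True
    then have "card A = 0 \<or> card A = 1" by auto
    then show ?thesis using less.prems by (intro exI[of _ id]) auto
  next
    case False
    then obtain i j where ij: "i \<in> A" "j \<in> A" "i \<noteq> j"
      using less.prems by (metis card_le_Suc0_iff_eq One_nat_def)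
    then have card: "card A = Suc (Suc (card (A - {i, j})))"
      using less.prems card_Suc_Diff1[of A i] card_Suc_Diff1[of "A - {i}" j]
      by (simp add: Diff_insert2[symmetric] insert_commute)
    then have "\<exists>\<pi>. (\<forall>k. \<pi> (\<pi> k) = k) \<and> (\<forall>k\<in>A - {i, j}. \<pi> k \<in> A - {i, j}) \<and>
        (even (card (A - {i, j})) \<longrightarrow> (\<forall>k\<in>A - {i, j}. \<pi> k \<noteq> k))"
      using less.prems by (intro less.hyps) auto
    then obtain \<pi> where \<pi>: "\<And>k. \<pi> (\<pi> k) = k" "\<And>k. k \<in> A - {i, j} \<Longrightarrow> \<pi> k \<in> A - {i, j}"
      "even (card (A - {i, j})) \<Longrightarrow> \<forall>k\<in>A - {i, j}. \<pi> k \<noteq> k" by blast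
    define \<rho> where "\<rho> k = (if k = i then j else if k = j then i else if k \<in> A then \<pi> k else k)" for k
    have "\<rho> (\<rho> k) = k" for k
      using \<pi>(1)[of k] \<pi>(2)[of k] ij unfolding \<rho>_def by auto
    moreover have "\<rho> k \<in> A" if "k \<in> A" for k
      using \<pi>(2)[of k] ij that unfolding \<rho>_def by auto
    moreover have "\<rho> k \<noteq> k" if "k \<in> A" "even (card A)" for k
    proof -
      have "even (card (A - {i, j}))" using that(2) unfolding card by simp
      then have "\<pi> k \<noteq> k" if "k \<in> A - {i, j}" using \<pi>(3) that by blast
      then show ?thesis using ij \<open>k \<in> A\<close> unfolding \<rho>_def by auto
    qed
    ultimately show ?thesis by blast
  qed
qed

text \<open>Chosen once for each index set and not for each vertex: only finitely many index sets
  occur at the vertices, so the choice costs no measurability.\<close>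

definition pairing :: "nat set \<Rightarrow> nat \<Rightarrow> nat" where
  "pairing A = (SOME \<pi>. (\<forall>i. \<pi> (\<pi> i) = i) \<and> (\<forall>i\<in>A. \<pi> i \<in> A) \<and>
     (even (card A) \<longrightarrow> (\<forall>i\<in>A. \<pi> i \<noteq> i)))"

lemma pairing:
  assumes "finite A"
  shows "pairing A (pairing A i) = i" "i \<in> A \<Longrightarrow> pairing A i \<in> A"
    "even (card A) \<Longrightarrow> i \<in> A \<Longrightarrow> pairing A i \<noteq> i"
  using someI_ex[OF ex_pairing[OF assms]] unfolding pairing_def[symmetric] by auto

lemma pairing_halves:
  assumes "finite A" "\<And>i. i \<in> A \<Longrightarrow> P (pairing A i) \<noteq> P i"
  shows "2 * card {i \<in> A. P i} = card A"
proof -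
  have "bij_betw (pairing A) {i \<in> A. P i} {i \<in> A. \<not> P i}"
    by (rule bij_betw_byWitness[where f' = "pairing A"]) (use assms pairing[OF assms(1)] in auto)
  then have "card {i \<in> A. P i} = card {i \<in> A. \<not> P i}" by (rule bij_betw_same_card)
  moreover have "card A = card {i \<in> A. P i} + card {i \<in> A. \<not> P i}"
    using assms(1) by (subst card_Un_disjoint[symmetric]) (auto intro: arg_cong[where f = card])
  ultimately show ?thesis by simp
qed

text \<open>Common form of orienting and of rounding: \<open>dart i u\<close> is the
  \<open>i\<close>-th edge end at \<open>u\<close>, \<open>\<kappa>\<close> returns the vertex,
  \<open>a\<close> exchanges the ends of an edge, and \<open>A u\<close> lists the ends to be
  balanced. The second involution pairs the ends in \<open>A u\<close>. Each of at most
  \<open>m\<close> ends misbehaves for at most four choices. Odd \<open>A u\<close> is excluded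
  because one end would remain unpaired.\<close>

lemma alternating_at_vertices:
  fixes M :: "'d measure" and U :: "'u measure"
  assumes spM: "space M = UNIV" and spU: "space U = UNIV"
    and \<phi> [measurable]: "\<phi> \<in> borel_measurable M" and \<phi>_inj: "inj (\<phi> :: 'd \<Rightarrow> real)"
    and a [measurable]: "a \<in> measurable M M" and a_a: "\<And>x. a (a x) = x"
    and \<kappa> [measurable]: "\<kappa> \<in> measurable M U"
    and dart: "\<And>i. i < m \<Longrightarrow> dart i \<in> measurable U M"
    and \<kappa>_dart: "\<And>i u. i < m \<Longrightarrow> \<kappa> (dart i u) = u"
    and dart_inj: "\<And>i j u. i < m \<Longrightarrow> j < m \<Longrightarrow> dart i u = dart j u \<Longrightarrow> i = j"
    and A_le: "\<And>u. A u \<subseteq> {..<m}" and A_sets: "\<And>i. {u. i \<in> A u} \<in> sets U"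
  shows "\<exists>f :: nat \<Rightarrow> 'd \<Rightarrow> bool. (\<forall>i. f i \<in> measurable M (count_space UNIV)) \<and>
     (\<forall>i x. a x \<noteq> x \<longrightarrow> f i (a x) \<noteq> f i x) \<and>
     (\<forall>u. card {i. i < K \<and> even (card (A u)) \<and> 2 * card {j \<in> A u. f i (dart j u)} \<noteq> card (A u)} \<le> 4 * m)"
proof -
  have finA: "finite (A u)" for u using A_le[of u] by (rule finite_subset) simp
  define D where "D i x = (if i < m then dart i (\<kappa> x) else x)" for i x
  have D [measurable]: "D i \<in> measurable M M" for i
    unfolding D_def using dart[of i] by (cases "i < m") (auto intro: measurable_compose[OF \<kappa>])
  \<comment> \<open>Recovers the index of an active end. The default \<open>m\<close> marks all
    other points; there \<open>D m\<close> is the identity, so \<open>b\<close> fixes them.\<close>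
  define idx where "idx x = (LEAST i. i = m \<or> (i < m \<and> i \<in> A (\<kappa> x) \<and> \<phi> (D i x) = \<phi> x))" for x
  have "{x. i \<in> A (\<kappa> x)} \<in> sets M" for i
    using measurable_sets[OF \<kappa> A_sets[of i]] by (simp add: spM vimage_def)
  then have A_pred [measurable]: "Measurable.pred M (\<lambda>x. i \<in> A (\<kappa> x))" for i
    by (simp add: pred_def spM)
  have idx [measurable]: "idx \<in> measurable M (count_space UNIV)"
    unfolding idx_def by measurable
  have AK: "(\<lambda>x. A (\<kappa> x)) \<in> measurable M (count_space (Pow {..<m}))"
  proof (subst measurable_count_space_eq_countable)
    have "{x. A (\<kappa> x) = B} = {x \<in> space M. \<forall>i\<in>{..<m}. (i \<in> A (\<kappa> x)) = (i \<in> B)}" if "B \<subseteq> {..<m}" for B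
      using that A_le by (auto simp: spM)
    then have "{x. A (\<kappa> x) = B} \<in> sets M" if "B \<subseteq> {..<m}" for B
      using that by simp
    then show "(\<lambda>x. A (\<kappa> x)) \<in> space M \<rightarrow> Pow {..<m} \<and>
        (\<forall>B\<in>Pow {..<m}. (\<lambda>x. A (\<kappa> x)) -` {B} \<inter> space M \<in> sets M)"
      using A_le by (auto simp: spM vimage_def)
  qed (simp add: countable_finite)
  define t where "t x = (if idx x < m then pairing (A (\<kappa> x)) (idx x) else m)" for x
  have "(\<lambda>x. pairing (A (\<kappa> x)) (idx x)) \<in> measurable M (count_space UNIV)"
    by (rule measurable_compose_countable'[OF _ AK, where f = "\<lambda>B x. pairing B (idx x)"])
      (auto simp: countable_finite)
  then have t [measurable]: "t \<in> measurable M (count_space UNIV)" unfolding t_def by measurable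
  define b where "b x = D (t x) x" for x
  have b: "b \<in> measurable M M"
    unfolding b_def by (rule measurable_compose_countable[OF D t])
  have idx_dart: "idx (dart i u) = i" if "i \<in> A u" for i u
  proof -
    have i: "i < m" using that A_le by blast
    show ?thesis unfolding idx_def
    proof (rule Least_equality)
      show "i = m \<or> i < m \<and> i \<in> A (\<kappa> (dart i u)) \<and> \<phi> (D i (dart i u)) = \<phi> (dart i u)"
        using i that by (simp add: D_def \<kappa>_dart)
      show "i \<le> j" if "j = m \<or> j < m \<and> j \<in> A (\<kappa> (dart i u)) \<and> \<phi> (D j (dart i u)) = \<phi> (dart i u)" for j
        using that i dart_inj[of j i u] \<phi>_inj by (auto simp: D_def \<kappa>_dart inj_eq)
    qed
  qed
  have b_dart: "b (dart i u) = dart (pairing (A u) i) u" if "i \<in> A u" for i u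
  proof -
    have "i < m" "pairing (A u) i < m" using that A_le pairing(2)[OF finA that] by blast+
    then show ?thesis by (simp add: b_def t_def idx_dart[OF that] \<kappa>_dart D_def)
  qed
  have idx_cases: "idx x = m \<or> (idx x < m \<and> idx x \<in> A (\<kappa> x) \<and> x = dart (idx x) (\<kappa> x))" for x
  proof -
    have "idx x = m \<or> (idx x < m \<and> idx x \<in> A (\<kappa> x) \<and> \<phi> (D (idx x) x) = \<phi> x)"
      unfolding idx_def by (rule LeastI[of _ m]) simp
    then show ?thesis using \<phi>_inj by (auto simp: D_def inj_eq)
  qed
  have b_b: "b (b x) = x" for x
  proof -
    consider "idx x = m" | i u where "i \<in> A u" "x = dart i u" using idx_cases[of x] by blast
    then show ?thesis
    proof cases
      case 1
      then show ?thesis by (simp add: b_def t_def D_def)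
    next
      case 2
      then show ?thesis using pairing[OF finA] by (simp add: b_dart)
    qed
  qed
  obtain f :: "nat \<Rightarrow> 'd \<Rightarrow> bool" where f: "\<forall>i. f i \<in> measurable M (count_space UNIV)"
    "\<forall>i x. a x \<noteq> x \<longrightarrow> f i (a x) \<noteq> f i x"
    "\<forall>x. b x \<noteq> x \<longrightarrow> card {i. i < K \<and> f i (b x) = f i x} \<le> 4"
    using involutions_almost_alternating[OF spM a b \<phi> a_a b_b \<phi>_inj, of K] by blast
  have "card {i. i < K \<and> even (card (A u)) \<and> 2 * card {j \<in> A u. f i (dart j u)} \<noteq> card (A u)} \<le> 4 * m"
    for u
  proof (cases "even (card (A u))")
    case True
    define F where "F j = {i. i < K \<and> f i (b (dart j u)) = f i (dart j u)}" for j
    have "card (F j) \<le> 4" if "j \<in> A u" for j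
    proof -
      have "pairing (A u) j \<in> A u" "pairing (A u) j \<noteq> j" using that True pairing[OF finA] by auto
      then have "b (dart j u) \<noteq> dart j u"
        using that A_le[of u] dart_inj[of "pairing (A u) j" j u] by (auto simp: b_dart)
      then show ?thesis unfolding F_def using f(3) by blast
    qed
    then have F4: "(\<Sum>j\<in>A u. card (F j)) \<le> (\<Sum>j\<in>A u. 4)" by (rule sum_mono)
    have "{i. i < K \<and> even (card (A u)) \<and> 2 * card {j \<in> A u. f i (dart j u)} \<noteq> card (A u)} \<subseteq> (\<Union>j\<in>A u. F j)"
    proof
      fix i assume i: "i \<in> {i. i < K \<and> even (card (A u)) \<and> 2 * card {j \<in> A u. f i (dart j u)} \<noteq> card (A u)}"
      then obtain j where "j \<in> A u" "f i (dart (pairing (A u) j) u) = f i (dart j u)"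
        using pairing_halves[OF finA[of u], of "\<lambda>j. f i (dart j u)"] by blast
      then show "i \<in> (\<Union>j\<in>A u. F j)" using i by (auto simp: F_def b_dart)
    qed
    then have "card {i. i < K \<and> even (card (A u)) \<and> 2 * card {j \<in> A u. f i (dart j u)} \<noteq> card (A u)} \<le> card (\<Union>j\<in>A u. F j)"
      by (rule card_mono[rotated]) (auto simp: F_def finA)
    also have "\<dots> \<le> (\<Sum>j\<in>A u. card (F j))" by (rule card_UN_le[OF finA])
    also have "\<dots> \<le> 4 * card (A u)" using F4 by simp
    also have "\<dots> \<le> 4 * m" using card_mono[OF _ A_le[of u]] by simp
    finally show ?thesis .
  qed simp
  then show ?thesis using f(1,2) by blast
qed

text \<open>Double counting: the \<open>K\<close> probabilities add up to the expected number of
  sets containing a point, which is at most \<open>c\<close>.\<close>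

lemma (in prob_space) ex_small_set_of_sparse_family:
  assumes "0 < K" and B: "\<And>i. i < K \<Longrightarrow> B i \<in> events"
    and sparse: "\<And>x. card {i. i < K \<and> x \<in> B i} \<le> c"
  shows "\<exists>i<K. prob (B i) \<le> real c / real K"
proof (rule ccontr)
  assume "\<not> ?thesis"
  then have "real c / real K < prob (B i)" if "i < K" for i using that by (meson not_le)
  then have "(\<Sum>i<K. real c / real K) < (\<Sum>i<K. prob (B i))"
    using assms(1) by (intro sum_strict_mono) auto
  also have "\<dots> = (\<Sum>i<K. expectation (indicator (B i)))" using B by (simp add: Int_absorb1 sets.sets_into_space)
  also have "\<dots> = expectation (\<lambda>x. \<Sum>i<K. indicator (B i) x)"
    by (rule Bochner_Integration.integral_sum[symmetric]) (use B in \<open>auto intro: integrable_real_indicator simp: emeasure_eq_measure\<close>)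
  also have "\<dots> \<le> expectation (\<lambda>x. real c)"
  proof (rule integral_mono)
    show "integrable M (\<lambda>x. \<Sum>i<K. indicator (B i) x :: real)"
      using B by (intro Bochner_Integration.integrable_sum integrable_real_indicator) (auto simp: emeasure_eq_measure)
    fix x
    have "(\<Sum>i<K. indicator (B i) x :: real) = real (card ({..<K} \<inter> {i. x \<in> B i}))"
      by (simp add: indicator_def sum.If_cases if_distrib[of "\<lambda>b. b"])
    also have "{..<K} \<inter> {i. x \<in> B i} = {i. i < K \<and> x \<in> B i}" by auto
    finally show "(\<Sum>i<K. indicator (B i) x :: real) \<le> real c" using sparse[of x] by simp
  qed simp
  also have "\<dots> = real c" by (simp add: prob_space)
  finally show False using assms(1) by simp
qed

lemma measurable_nat_nat:
  fixes F :: "nat \<Rightarrow> nat \<Rightarrow> 'b"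
  assumes "f \<in> measurable M (count_space UNIV)" "g \<in> measurable M (count_space UNIV)"
  shows "(\<lambda>x. F (f x) (g x)) \<in> measurable M (count_space UNIV)"
proof (rule measurable_compose_countable[OF _ assms(1)])
  show "(\<lambda>x. F i (g x)) \<in> measurable M (count_space UNIV)" for i
    by (rule measurable_compose[OF assms(2)]) simp
qed

lemma measurable_nat_sum:
  fixes f :: "'i \<Rightarrow> 'b \<Rightarrow> nat"
  assumes "finite I" "\<And>i. i \<in> I \<Longrightarrow> f i \<in> measurable M (count_space UNIV)"
  shows "(\<lambda>x. \<Sum>i\<in>I. f i x) \<in> measurable M (count_space UNIV)"
  using assms
proof (induction I rule: finite_induct)
  case (insert i I)
  then show ?case using measurable_nat_nat[of "f i" M "\<lambda>x. \<Sum>i\<in>I. f i x" "(+)"] by simp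
qed simp

section \<open>Almost balanced orientations and halving of weights\<close>

text \<open>Twice a rounded odd number is one too large or one too small, so the total is halved
  exactly when half of the odd entries are rounded up.\<close>

lemma sum_round_half:
  fixes x :: "'i \<Rightarrow> nat"
  assumes "finite I"
  shows "2 * (\<Sum>j\<in>I. x j div 2 + of_bool (odd (x j) \<and> P j)) + card {j \<in> I. odd (x j)}
    = (\<Sum>j\<in>I. x j) + 2 * card {j \<in> I. odd (x j) \<and> P j}"
proof -
  have count: "card {j \<in> I. Q j} = (\<Sum>j\<in>I. of_bool (Q j))" for Q
    using assms by (simp add: sum_of_bool_eq Int_def)
  have "2 * (x j div 2 + of_bool (odd (x j) \<and> P j)) + of_bool (odd (x j))
      = x j + 2 * of_bool (odd (x j) \<and> P j)" for j
    by (cases "odd (x j)") (auto elim!: oddE evenE)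
  then have "(\<Sum>j\<in>I. 2 * (x j div 2 + of_bool (odd (x j) \<and> P j)) + of_bool (odd (x j)))
      = (\<Sum>j\<in>I. x j + 2 * of_bool (odd (x j) \<and> P j))"
    by (intro sum.cong) simp_all
  then show ?thesis
    unfolding count by (simp only: sum.distrib distrib_left sum_distrib_left)
qed

lemma card_complementary_half:
  assumes "finite A" "2 * card {j \<in> A. P j} = card A"
  shows "2 * card {j \<in> A. \<not> P j} = card A"
proof -
  have "card A = card {j \<in> A. P j} + card {j \<in> A. \<not> P j}"
    using assms(1) by (subst card_Un_disjoint[symmetric]) (auto intro: arg_cong[where f = card])
  then show ?thesis using assms(2) by simp
qed

lemma measurable_card_nat:
  assumes "finite I" "\<And>i. i \<in> I \<Longrightarrow> Measurable.pred M (P i)"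
  shows "(\<lambda>x. card {i \<in> I. P i x}) \<in> measurable M (count_space UNIV)"
proof -
  have count: "card {i \<in> I. P i x} = (\<Sum>i\<in>I. of_bool (P i x))" for x
    using assms(1) by (simp add: sum_of_bool_eq Int_def)
  have "(\<lambda>x. of_bool (P i x) :: nat) \<in> measurable M (count_space UNIV)" if "i \<in> I" for i
    by (rule measurable_compose[OF assms(2)[OF that]]) simp
  then show ?thesis unfolding count by (rule measurable_nat_sum[OF assms(1)])
qed

section \<open>Borel graphs with enumerated neighbours\<close>

locale enumerated_graph =
  fixes E :: "('a::polish_space \<times> 'a) set" and d :: nat and h :: "nat \<Rightarrow> 'a \<Rightarrow> 'a"
  assumes E_sets [measurable]: "E \<in> sets (borel \<Otimes>\<^sub>M borel)"
    and E_sym: "(x, y) \<in> E \<Longrightarrow> (y, x) \<in> E" and E_irrefl: "(x, x) \<notin> E"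
    and h_meas: "i < d \<Longrightarrow> h i \<in> borel_measurable borel"
    and h_inj: "inj_on (\<lambda>i. h i v) {..<d}"
    and h_section: "{w. (v, w) \<in> E} = (\<lambda>i. h i v) ` {..<d}"
begin

abbreviation VV :: "('a \<times> 'a) measure" where "VV \<equiv> borel \<Otimes>\<^sub>M borel"

lemma h_edge: "i < d \<Longrightarrow> (v, h i v) \<in> E" "i < d \<Longrightarrow> (h i v, v) \<in> E"
  using h_section[of v] E_sym by blast+

lemma space_VV [simp]: "space VV = UNIV"
  by (simp add: space_pair_measure)

definition outdeg :: "('a \<times> 'a) set \<Rightarrow> 'a \<Rightarrow> nat" where
  "outdeg S v = card {i \<in> {..<d}. (v, h i v) \<in> S}"

definition indeg :: "('a \<times> 'a) set \<Rightarrow> 'a \<Rightarrow> nat" where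
  "indeg S v = card {i \<in> {..<d}. (h i v, v) \<in> S}"

lemma measurable_edge_at:
  assumes "i < d"
  shows "(\<lambda>v. (v, h i v)) \<in> measurable borel VV" "(\<lambda>v. (h i v, v)) \<in> measurable borel VV"
  using h_meas[OF assms] by (auto intro: measurable_Pair)

lemma outdeg_meas: "S \<in> sets VV \<Longrightarrow> outdeg S \<in> measurable borel (count_space UNIV)"
  unfolding outdeg_def
  by (intro measurable_card_nat pred_sets2[OF _ measurable_edge_at(1)]) auto

lemma indeg_meas: "S \<in> sets VV \<Longrightarrow> indeg S \<in> measurable borel (count_space UNIV)"
  unfolding indeg_def
  by (intro measurable_card_nat pred_sets2[OF _ measurable_edge_at(2)]) auto

text \<open>The end of an edge at \<open>u\<close> is the ordered pair \<open>(u, h j u)\<close>,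
  the involution is the swap, and colour \<open>True\<close> means outgoing. The swap always changes
  the colour, so the orientation is valid everywhere and only the balance can fail.\<close>

lemma ex_almost_balanced_orientation:
  assumes \<mu>: "prob_space \<mu>" "sets \<mu> = sets borel" and "\<epsilon> > 0" and "even d"
  shows "\<exists>S. orientation E S \<and>
     measure \<mu> {v. \<not> (2 * outdeg S v = d \<and> 2 * indeg S v = d)} \<le> \<epsilon>"
proof -
  interpret prob_space \<mu> by fact
  obtain \<phi> :: "'a \<times> 'a \<Rightarrow> real" where \<phi>: "\<phi> \<in> borel_measurable VV" "inj \<phi>"
    using ex_borel_injection[where 'a = "'a \<times> 'a"] by (auto simp: borel_prod)
  obtain K :: nat where K: "real (4 * d) / \<epsilon> < real K" using reals_Archimedean2 by blast
  have "K > 0" using K assms(3) by (cases K) (auto simp: divide_less_0_iff)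
  have "\<exists>f :: nat \<Rightarrow> 'a \<times> 'a \<Rightarrow> bool. (\<forall>i. f i \<in> measurable VV (count_space UNIV)) \<and>
     (\<forall>i x. prod.swap x \<noteq> x \<longrightarrow> f i (prod.swap x) \<noteq> f i x) \<and>
     (\<forall>u. card {i. i < K \<and> even (card {..<d}) \<and> 2 * card {j \<in> {..<d}. f i (u, h j u)} \<noteq> card {..<d}} \<le> 4 * d)"
    by (rule alternating_at_vertices[where U = borel and \<kappa> = fst])
      (use \<phi> measurable_edge_at(1) h_inj in \<open>auto simp: measurable_pair_swap' space_pair_measure prod.swap_def dest: inj_onD\<close>)
  then obtain f :: "nat \<Rightarrow> 'a \<times> 'a \<Rightarrow> bool" where f: "\<forall>i. f i \<in> measurable VV (count_space UNIV)"
     "\<forall>i x. prod.swap x \<noteq> x \<longrightarrow> f i (prod.swap x) \<noteq> f i x"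
     "\<forall>u. card {i. i < K \<and> even (card {..<d}) \<and> 2 * card {j \<in> {..<d}. f i (u, h j u)} \<noteq> card {..<d}} \<le> 4 * d"
    by blast
  have f_meas [measurable]: "f i \<in> measurable VV (count_space UNIV)" for i using f(1) by blast
  define S where "S i = {e \<in> E. f i e}" for i
  have swap: "f i (y, x) \<longleftrightarrow> \<not> f i (x, y)" if "(x, y) \<in> E" for i x y
    using f(2)[rule_format, of "(x, y)" i] that E_irrefl by (cases "x = y") auto
  have "S i = E \<inter> {e \<in> space VV. f i e}" for i by (auto simp: S_def)
  then have S_sets: "S i \<in> sets VV" for i by simp
  have orient: "orientation E (S i)" for i
    unfolding orientation_def
  proof (intro conjI allI impI)
    show "S i \<subseteq> E" by (auto simp: S_def)
    show "(x, y) \<in> S i \<longleftrightarrow> (y, x) \<notin> S i" if "(x, y) \<in> E" for x y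
      using swap[OF that] that E_sym[OF that] by (simp add: S_def)
  qed (rule S_sets)
  define B where "B i = {v. 2 * card {j \<in> {..<d}. f i (v, h j v)} \<noteq> d}" for i
  have "{v \<in> space borel. 2 * card {j \<in> {..<d}. f i (v, h j v)} \<noteq> d} \<in> sets borel" for i
  proof -
    have "(\<lambda>v. card {j \<in> {..<d}. f i (v, h j v)}) \<in> measurable borel (count_space UNIV)"
      by (rule measurable_card_nat) (auto intro!: measurable_compose[OF measurable_edge_at(1) f_meas])
    then show ?thesis by measurable
  qed
  then have B_sets: "B i \<in> events" for i
    unfolding B_def \<mu>(2) by (simp only: space_borel UNIV_I simp_thms)
  have B_sparse: "card {i. i < K \<and> v \<in> B i} \<le> 4 * d" for v using f(3)[rule_format, of v] \<open>even d\<close> by (simp add: B_def)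
  obtain i where i: "prob (B i) \<le> real (4 * d) / real K"
    using ex_small_set_of_sparse_family[OF \<open>K > 0\<close> B_sets B_sparse] by blast
  have "{v. \<not> (2 * outdeg (S i) v = d \<and> 2 * indeg (S i) v = d)} \<subseteq> B i"
  proof
    fix v assume v: "v \<in> {v. \<not> (2 * outdeg (S i) v = d \<and> 2 * indeg (S i) v = d)}"
    show "v \<in> B i"
    proof (rule ccontr)
      assume "v \<notin> B i"
      then have half: "2 * card {j \<in> {..<d}. f i (v, h j v)} = card {..<d}" by (simp add: B_def)
      have "{j \<in> {..<d}. (v, h j v) \<in> S i} = {j \<in> {..<d}. f i (v, h j v)}"
        using h_edge by (auto simp: S_def)
      moreover have "(h j v, v) \<in> S i \<longleftrightarrow> \<not> f i (v, h j v)" if "j < d" for j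
        using swap[OF h_edge(1)[OF that]] h_edge(2)[OF that] by (simp add: S_def)
      then have "{j \<in> {..<d}. (h j v, v) \<in> S i} = {j \<in> {..<d}. \<not> f i (v, h j v)}" by auto
      ultimately show False
        using v half card_complementary_half[OF _ half] by (simp add: outdeg_def indeg_def)
    qed
  qed
  then have "prob {v. \<not> (2 * outdeg (S i) v = d \<and> 2 * indeg (S i) v = d)} \<le> prob (B i)"
    using B_sets by (intro finite_measure_mono)
  also have "\<dots> \<le> \<epsilon>"
  proof -
    have "real (4 * d) < real K * \<epsilon>" using K assms(3) by (simp add: pos_divide_less_eq)
    then have "real (4 * d) / real K \<le> \<epsilon>" using \<open>K > 0\<close> by (simp add: pos_divide_le_eq mult.commute)
    then show ?thesis using i by linarith
  qed
  finally show ?thesis using orient by blast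
qed

text \<open>A weight lives on the bipartite graph joining an out-copy and an in-copy of the vertex set;
  index \<open>d\<close> of \<open>nbr\<close> is the extra edge joining the two copies of the same vertex.\<close>

definition nbr :: "nat \<Rightarrow> 'a \<Rightarrow> 'a" where
  "nbr i v = (if i < d then h i v else v)"

lemma nbr_inj: "i \<le> d \<Longrightarrow> j \<le> d \<Longrightarrow> nbr i v = nbr j v \<Longrightarrow> i = j"
proof -
  have "h k v \<noteq> v" if "k < d" for k using h_edge(1)[OF that, of v] E_irrefl[of v] by metis
  then show "i \<le> d \<Longrightarrow> j \<le> d \<Longrightarrow> nbr i v = nbr j v \<Longrightarrow> i = j"
    using inj_onD[OF h_inj[of v], of i j] unfolding nbr_def
    by (cases "i < d"; cases "j < d") (simp, metis, metis, simp)
qed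

lemma nbr_meas [measurable]: "nbr i \<in> borel_measurable borel"
  unfolding nbr_def using h_meas by (cases "i < d") auto

definition out_weight :: "('a \<times> 'a \<Rightarrow> nat) \<Rightarrow> 'a \<Rightarrow> nat" where
  "out_weight w v = (\<Sum>i\<le>d. w (v, nbr i v))"

definition in_weight :: "('a \<times> 'a \<Rightarrow> nat) \<Rightarrow> 'a \<Rightarrow> nat" where
  "in_weight w v = (\<Sum>i\<le>d. w (nbr i v, v))"

lemma weight_meas:
  assumes [measurable]: "w \<in> measurable VV (count_space UNIV)"
  shows "out_weight w \<in> measurable borel (count_space UNIV)"
    "in_weight w \<in> measurable borel (count_space UNIV)"
proof -
  have "(\<lambda>v. w (v, nbr i v)) \<in> measurable borel (count_space UNIV)"
    "(\<lambda>v. w (nbr i v, v)) \<in> measurable borel (count_space UNIV)" for i by measurable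
  then show "out_weight w \<in> measurable borel (count_space UNIV)"
    "in_weight w \<in> measurable borel (count_space UNIV)"
    unfolding out_weight_def in_weight_def by (intro measurable_nat_sum; simp)+
qed

text \<open>An odd sum cannot be halved exactly, hence the parity conditions; the sums of interest
  are powers of two.\<close>

definition halved :: "('a \<times> 'a \<Rightarrow> nat) \<Rightarrow> ('a \<times> 'a \<Rightarrow> nat) \<Rightarrow> 'a \<Rightarrow> bool" where
  "halved w w' v \<longleftrightarrow> (even (out_weight w v) \<longrightarrow> 2 * out_weight w' v = out_weight w v) \<and>
     (even (in_weight w v) \<longrightarrow> 2 * in_weight w' v = in_weight w v)"

lemma halved_sets:
  assumes "w \<in> measurable VV (count_space UNIV)" "w' \<in> measurable VV (count_space UNIV)"
  shows "{v. halved w w' v} \<in> sets borel"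
proof -
  have "Measurable.pred borel (\<lambda>v. even (x v) \<longrightarrow> 2 * y v = x v)"
    if "x \<in> measurable borel (count_space UNIV)" "y \<in> measurable borel (count_space UNIV)" for x y :: "'a \<Rightarrow> nat"
    by (rule measurable_nat_nat[OF that, of "\<lambda>m n. even m \<longrightarrow> 2 * n = m"])
  from this[OF weight_meas(1)[OF assms(1)] weight_meas(1)[OF assms(2)]]
    this[OF weight_meas(2)[OF assms(1)] weight_meas(2)[OF assms(2)]]
  have "Measurable.pred borel (halved w w')"
    unfolding halved_def by (rule pred_intros_logic(3))
  then show ?thesis by (simp only: pred_def space_borel UNIV_I simp_thms)
qed

text \<open>An even total has an even number of odd entries, so their ends can be paired. If
  \<open>P\<close> splits them evenly, rounding up by \<open>P\<close> or by its negation is equally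
  good.\<close>

lemma round_half_halves:
  fixes e :: "nat \<Rightarrow> 'a \<times> 'a" and w :: "'a \<times> 'a \<Rightarrow> nat"
  assumes "even (card {j \<in> {..d}. odd (w (e j))}) \<Longrightarrow>
      2 * card {j \<in> {j \<in> {..d}. odd (w (e j))}. P (e j)} = card {j \<in> {..d}. odd (w (e j))}"
    and "even (\<Sum>j\<le>d. w (e j))"
  shows "2 * (\<Sum>j\<le>d. w (e j) div 2 + of_bool (odd (w (e j)) \<and> P (e j))) = (\<Sum>j\<le>d. w (e j))"
    and "2 * (\<Sum>j\<le>d. w (e j) div 2 + of_bool (odd (w (e j)) \<and> \<not> P (e j))) = (\<Sum>j\<le>d. w (e j))"
proof -
  let ?A = "{j \<in> {..d}. odd (w (e j))}"
  have "2 * (\<Sum>j\<le>d. w (e j) div 2) + card ?A = (\<Sum>j\<le>d. w (e j))"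
    using sum_round_half[of "{..d}" "\<lambda>j. w (e j)" "\<lambda>_. False"] by simp
  moreover have "even c" if "2 * m + c = n" "even n" for m c n :: nat using that by presburger
  ultimately have "even (card ?A)" using assms(2) by blast
  then have half: "2 * card {j \<in> ?A. P (e j)} = card ?A" by (rule assms(1))
  have half': "2 * card {j \<in> ?A. \<not> P (e j)} = card ?A"
    by (rule card_complementary_half[OF _ half]) simp
  have eq: "{j \<in> ?A. Q j} = {j \<in> {..d}. odd (w (e j)) \<and> Q j}" for Q by auto
  show "2 * (\<Sum>j\<le>d. w (e j) div 2 + of_bool (odd (w (e j)) \<and> P (e j))) = (\<Sum>j\<le>d. w (e j))"
    using sum_round_half[of "{..d}" "\<lambda>j. w (e j)" "\<lambda>j. P (e j)"] half unfolding eq by simp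
  show "2 * (\<Sum>j\<le>d. w (e j) div 2 + of_bool (odd (w (e j)) \<and> \<not> P (e j))) = (\<Sum>j\<le>d. w (e j))"
    using sum_round_half[of "{..d}" "\<lambda>j. w (e j)" "\<lambda>j. \<not> P (e j)"] half' unfolding eq by simp
qed

text \<open>An edge \<open>e\<close> has the end \<open>(e, True)\<close> at the out-copy of its
  tail and \<open>(e, False)\<close> at the in-copy of its head; only edges of odd weight are
  active. The ends have opposite colours, so rounding up by the colour of one end or of the other
  splits \<open>w\<close> into two weights.\<close>

lemma ex_almost_halving:
  assumes \<mu>: "prob_space \<mu>" "sets \<mu> = sets borel" and "\<epsilon> > 0"
    and w [measurable]: "w \<in> measurable VV (count_space UNIV)"
  shows "\<exists>w'. w' \<in> measurable VV (count_space UNIV) \<and> (\<forall>e. w e = 0 \<longrightarrow> w' e = 0) \<and>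
     measure \<mu> {v. \<not> halved w w' v} \<le> \<epsilon> \<and>
     2 * (\<integral>\<^sup>+v. of_nat (w' (v, v)) \<partial>\<mu>) \<le> (\<integral>\<^sup>+v. of_nat (w (v, v)) \<partial>\<mu>)"
proof -
  interpret prob_space \<mu> by fact
  let ?M = "VV \<Otimes>\<^sub>M count_space (UNIV :: bool set)"
  let ?U = "(borel :: 'a measure) \<Otimes>\<^sub>M count_space (UNIV :: bool set)"
  obtain \<phi> :: "'a \<times> 'a \<Rightarrow> real" where "\<phi> \<in> borel_measurable VV" "inj \<phi>"
    using ex_borel_injection[where 'a = "'a \<times> 'a"] by (auto simp: borel_prod)
  then obtain \<psi> :: "('a \<times> 'a) \<times> bool \<Rightarrow> real" where \<psi>: "\<psi> \<in> borel_measurable ?M" "inj \<psi>"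
    using ex_injection_times_bool by blast
  obtain K :: nat where K: "real (8 * Suc d) / \<epsilon> < real K" using reals_Archimedean2 by blast
  have "K > 0" using K assms(3) by (cases K) (auto simp: divide_less_0_iff)
  define a where "a p = (fst p, \<not> snd p)" for p :: "('a \<times> 'a) \<times> bool"
  define \<kappa> where "\<kappa> p = (if snd p then fst (fst p) else snd (fst p), snd p)" for p :: "('a \<times> 'a) \<times> bool"
  define dart where "dart j u = (if snd u then (fst u, nbr j (fst u)) else (nbr j (fst u), fst u), snd u)"
    for j and u :: "'a \<times> bool"
  define A where "A u = {j \<in> {..d}. odd (w (fst (dart j u)))}" for u
  have dart_meas [measurable]: "dart j \<in> measurable ?U ?M" for j unfolding dart_def by measurable
  have "\<exists>f :: nat \<Rightarrow> ('a \<times> 'a) \<times> bool \<Rightarrow> bool. (\<forall>i. f i \<in> measurable ?M (count_space UNIV)) \<and>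
     (\<forall>i x. a x \<noteq> x \<longrightarrow> f i (a x) \<noteq> f i x) \<and>
     (\<forall>u. card {i. i < K \<and> even (card (A u)) \<and> 2 * card {j \<in> A u. f i (dart j u)} \<noteq> card (A u)} \<le> 4 * Suc d)"
  proof (rule alternating_at_vertices[where U = ?U and \<kappa> = \<kappa> and \<phi> = \<psi>])
    show "a \<in> measurable ?M ?M" unfolding a_def by measurable
    show "\<kappa> \<in> measurable ?M ?U" unfolding \<kappa>_def by measurable
    show "i = j" if "i < Suc d" "j < Suc d" "dart i u = dart j u" for i j u
      using that nbr_inj[of i j "fst u"] by (auto simp: dart_def split: if_splits)
    show "{u. j \<in> A u} \<in> sets ?U" for j
    proof (cases "j \<le> d")
      case True
      have "{u \<in> space ?U. odd (w (fst (dart j u)))} \<in> sets ?U" by measurable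
      then show ?thesis using True by (simp add: A_def space_pair_measure)
    qed (simp add: A_def)
  qed (use \<psi> in \<open>auto simp: space_pair_measure a_def \<kappa>_def dart_def A_def\<close>)
  then obtain f :: "nat \<Rightarrow> ('a \<times> 'a) \<times> bool \<Rightarrow> bool"
    where f: "\<forall>i. f i \<in> measurable ?M (count_space UNIV)" "\<forall>i x. a x \<noteq> x \<longrightarrow> f i (a x) \<noteq> f i x"
     "\<forall>u. card {i. i < K \<and> even (card (A u)) \<and> 2 * card {j \<in> A u. f i (dart j u)} \<noteq> card (A u)} \<le> 4 * Suc d"
    by blast
  have f_meas [measurable]: "f i \<in> measurable ?M (count_space UNIV)" for i using f(1) by blast
  have opp: "f i (e, False) \<longleftrightarrow> \<not> f i (e, True)" for i e
    using f(2)[rule_format, of "(e, True)" i] by (simp add: a_def)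
  define part where "part i s e = w e div 2 + of_bool (odd (w e) \<and> f i (e, s))" for i s e
  have part_meas [measurable]: "part i s \<in> measurable VV (count_space UNIV)" for i s
    unfolding part_def by measurable
  define X where "X u = {i. i < K \<and> even (card (A u)) \<and> 2 * card {j \<in> A u. f i (dart j u)} \<noteq> card (A u)}" for u
  have good: "halved w (part i s) v" if "i < K" "i \<notin> X (v, True)" "i \<notin> X (v, False)" for i s v
  proof -
    have 1: "2 * card {j \<in> {j \<in> {..d}. odd (w (v, nbr j v))}. f i ((v, nbr j v), True)} =
       card {j \<in> {..d}. odd (w (v, nbr j v))}" if "even (card {j \<in> {..d}. odd (w (v, nbr j v))})"
      using that \<open>i < K\<close> \<open>i \<notin> X (v, True)\<close> unfolding X_def A_def by (simp add: dart_def)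
    have 2: "2 * card {j \<in> {j \<in> {..d}. odd (w (nbr j v, v))}. f i ((nbr j v, v), False)} =
       card {j \<in> {..d}. odd (w (nbr j v, v))}" if "even (card {j \<in> {..d}. odd (w (nbr j v, v))})"
      using that \<open>i < K\<close> \<open>i \<notin> X (v, False)\<close> unfolding X_def A_def by (simp add: dart_def)
    show ?thesis
      using round_half_halves[where e = "\<lambda>j. (v, nbr j v)" and w = w and P = "\<lambda>e. f i (e, True)", OF 1]
        round_half_halves[where e = "\<lambda>j. (nbr j v, v)" and w = w and P = "\<lambda>e. f i (e, False)", OF 2]
      unfolding halved_def out_weight_def in_weight_def part_def by (cases s) (simp_all add: opp)
  qed
  define B where "B i = - {v. halved w (part i True) v} \<union> - {v. halved w (part i False) v}" for i
  have B_sets: "B i \<in> events" for i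
    unfolding B_def \<mu>(2) using halved_sets[OF w part_meas] by (intro sets.Un) (auto intro: borel_comp)
  \<comment> \<open>Both copies of \<open>v\<close> contribute, each \<open>4 * Suc d\<close>; the
    successor accounts for the loop.\<close>
  have B_sparse: "card {i. i < K \<and> v \<in> B i} \<le> 8 * Suc d" for v
  proof -
    have "{i. i < K \<and> v \<in> B i} \<subseteq> X (v, True) \<union> X (v, False)" using good by (auto simp: B_def)
    then have "card {i. i < K \<and> v \<in> B i} \<le> card (X (v, True) \<union> X (v, False))"
      by (intro card_mono) (auto simp: X_def)
    also have "\<dots> \<le> card (X (v, True)) + card (X (v, False))" by (rule card_Un_le)
    also have "\<dots> \<le> 4 * Suc d + 4 * Suc d" using f(3) unfolding X_def by (intro add_mono) blast+
    finally show ?thesis by simp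
  qed
  obtain i where i: "prob (B i) \<le> real (8 * Suc d) / real K"
    using ex_small_set_of_sparse_family[OF \<open>K > 0\<close> B_sets B_sparse] by blast
  have "real (8 * Suc d) < real K * \<epsilon>" using K assms(3) by (simp add: pos_divide_less_eq)
  then have "real (8 * Suc d) / real K \<le> \<epsilon>" using \<open>K > 0\<close> by (simp add: pos_divide_le_eq mult.commute)
  then have B_small: "prob (B i) \<le> \<epsilon>" using i by linarith
  have bad: "prob {v. \<not> halved w (part i s) v} \<le> \<epsilon>" for s
  proof -
    have "prob {v. \<not> halved w (part i s) v} \<le> prob (B i)"
      using B_sets by (intro finite_measure_mono) (cases s; auto simp: B_def)+
    then show ?thesis using B_small by linarith
  qed
  define I where "I s = (\<integral>\<^sup>+v. of_nat (part i s (v, v)) \<partial>\<mu>)" for s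
  have meas_\<mu>: "(\<lambda>v. of_nat (part i s (v, v)) :: ennreal) \<in> borel_measurable \<mu>" for s
  proof -
    have "(\<lambda>v. of_nat (part i s (v, v)) :: ennreal) \<in> borel_measurable borel" by measurable
    then show ?thesis by (simp add: measurable_cong_sets[OF \<mu>(2) refl])
  qed
  have "w e = part i True e + part i False e" for e
    unfolding part_def by (cases "odd (w e)"; cases "f i (e, True)") (auto simp: opp elim!: oddE evenE)
  then have "(\<integral>\<^sup>+v. of_nat (w (v, v)) \<partial>\<mu>) = I True + I False"
    unfolding I_def by (simp add: nn_integral_add[symmetric] meas_\<mu>)
  \<comment> \<open>The better of the two roundings carries at most half of the loop weight.\<close>
  moreover have "\<exists>s. 2 * I s \<le> I True + I False"
    using add_mono[of "I True" "I True" "I True" "I False"] add_mono[of "I False" "I True" "I False" "I False"]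
      linear[of "I True" "I False"] by (metis mult_2 order_refl)
  ultimately obtain s where "2 * I s \<le> (\<integral>\<^sup>+v. of_nat (w (v, v)) \<partial>\<mu>)" by auto
  then show ?thesis using part_meas bad unfolding I_def
    by (intro exI[of _ "part i s"]) (auto simp: part_def)
qed

end

section \<open>Matchings and colourings\<close>

lemma rainbow_insert:
  fixes k :: nat
  assumes "X \<subseteq> dom c'" "inj_on c' X" "\<And>e i. c' e = Some i \<Longrightarrow> i < k"
    and "card Y = 1" "\<And>e. e \<in> Y \<Longrightarrow> c e = Some k" "\<And>e. e \<in> X \<Longrightarrow> c e = c' e"
  shows "X \<union> Y \<subseteq> dom c" "inj_on c (X \<union> Y)"
proof -
  obtain y where Y: "Y = {y}" using \<open>card Y = 1\<close> by (auto simp: card_1_singleton_iff)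
  show "X \<union> Y \<subseteq> dom c"
  proof
    fix e assume "e \<in> X \<union> Y"
    then show "e \<in> dom c" using assms(1,5,6) by (cases "e \<in> Y") (auto simp: dom_def)
  qed
  have "inj_on c X" using assms(2,6) by (simp add: inj_on_def)
  moreover have "c e \<noteq> c y" if "e \<in> X" for e
    using assms(3)[of e k] assms(5)[of y] assms(6)[OF that] Y by (metis insertI1 less_irrefl)
  then have "c y \<notin> c ` (X - {y})" by force
  ultimately show "inj_on c (X \<union> Y)" unfolding Y by simp
qed

context enumerated_graph
begin

definition uniform :: "nat \<Rightarrow> ('a \<times> 'a \<Rightarrow> nat) \<Rightarrow> 'a \<Rightarrow> bool" where
  "uniform k w v \<longleftrightarrow> out_weight w v = k \<and> in_weight w v = k"

lemma uniform_sets: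
  assumes "w \<in> measurable VV (count_space UNIV)"
  shows "{v. uniform k w v} \<in> sets borel"
proof -
  have "Measurable.pred borel (\<lambda>v. out_weight w v = k \<and> in_weight w v = k)"
    by (rule measurable_nat_nat[OF weight_meas[OF assms], of "\<lambda>m n. m = k \<and> n = k"])
  then show ?thesis unfolding uniform_def by (simp only: pred_def space_borel UNIV_I simp_thms)
qed

text \<open>Half of the tolerance pays for the present halving and half for the remaining
  \<open>t\<close>. Where it succeeds, uniform weight \<open>2 ^ Suc t\<close> becomes uniform
  weight \<open>2 ^ t\<close>.\<close>

lemma ex_almost_unit_weight:
  assumes \<mu>: "prob_space \<mu>" "sets \<mu> = sets borel" and "\<epsilon> > 0"
    and w: "w \<in> measurable VV (count_space UNIV)"
  shows "\<exists>w'. w' \<in> measurable VV (count_space UNIV) \<and> (\<forall>e. w e = 0 \<longrightarrow> w' e = 0) \<and>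
     measure \<mu> {v. uniform (2 ^ t) w v \<and> \<not> uniform 1 w' v} \<le> \<epsilon> \<and>
     2 ^ t * (\<integral>\<^sup>+v. of_nat (w' (v, v)) \<partial>\<mu>) \<le> (\<integral>\<^sup>+v. of_nat (w (v, v)) \<partial>\<mu>)"
  using assms(3,4)
proof (induction t arbitrary: w \<epsilon>)
  case 0
  then show ?case by (intro exI[of _ w]) simp
next
  case (Suc t)
  interpret prob_space \<mu> by fact
  obtain w1 where w1: "w1 \<in> measurable VV (count_space UNIV)" "\<forall>e. w e = 0 \<longrightarrow> w1 e = 0"
    "prob {v. \<not> halved w w1 v} \<le> \<epsilon> / 2"
    "2 * (\<integral>\<^sup>+v. of_nat (w1 (v, v)) \<partial>\<mu>) \<le> (\<integral>\<^sup>+v. of_nat (w (v, v)) \<partial>\<mu>)"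
    using ex_almost_halving[OF \<mu> _ Suc.prems(2), of "\<epsilon> / 2"] Suc.prems(1) by auto
  obtain w' where w': "w' \<in> measurable VV (count_space UNIV)" "\<forall>e. w1 e = 0 \<longrightarrow> w' e = 0"
    "prob {v. uniform (2 ^ t) w1 v \<and> \<not> uniform 1 w' v} \<le> \<epsilon> / 2"
    "2 ^ t * (\<integral>\<^sup>+v. of_nat (w' (v, v)) \<partial>\<mu>) \<le> (\<integral>\<^sup>+v. of_nat (w1 (v, v)) \<partial>\<mu>)"
    using Suc.IH[OF _ w1(1), of "\<epsilon> / 2"] Suc.prems(1) by auto
  let ?A = "{v. \<not> halved w w1 v}" and ?B = "{v. uniform (2 ^ t) w1 v \<and> \<not> uniform 1 w' v}"
  have A: "?A \<in> events"
    using borel_comp[OF halved_sets[OF Suc.prems(2) w1(1)]] by (simp add: \<mu>(2) Collect_neg_eq)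
  have "{v. uniform (2 ^ t) w1 v} - {v. uniform 1 w' v} \<in> events"
    using uniform_sets w1(1) w'(1) by (simp add: \<mu>(2) sets.Diff)
  then have B: "?B \<in> events" by (simp add: set_diff_eq)
  have "{v. uniform (2 ^ Suc t) w v \<and> \<not> uniform 1 w' v} \<subseteq> ?A \<union> ?B"
    unfolding uniform_def halved_def by auto
  then have "prob {v. uniform (2 ^ Suc t) w v \<and> \<not> uniform 1 w' v} \<le> prob (?A \<union> ?B)"
    using A B by (intro finite_measure_mono) auto
  also have "\<dots> \<le> prob ?A + prob ?B" by (rule measure_Un_le[OF A B])
  finally have "prob {v. uniform (2 ^ Suc t) w v \<and> \<not> uniform 1 w' v} \<le> \<epsilon>"
    using w1(3) w'(3) by simp
  moreover have "2 ^ Suc t * (\<integral>\<^sup>+v. of_nat (w' (v, v)) \<partial>\<mu>) \<le> (\<integral>\<^sup>+v. of_nat (w (v, v)) \<partial>\<mu>)"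
    using mult_left_mono[OF w'(4), of 2] w1(4) by (simp add: mult.assoc order_trans)
  ultimately show ?case using w' w1(2) by blast
qed

lemma regular_meas:
  assumes "S \<in> sets VV"
  shows "{v. outdeg S v = k \<and> indeg S v = k} \<in> sets borel"
proof -
  have "Measurable.pred borel (\<lambda>v. outdeg S v = k \<and> indeg S v = k)"
    by (rule measurable_nat_nat[OF outdeg_meas[OF assms] indeg_meas[OF assms], of "\<lambda>m n. m = k \<and> n = k"])
  then show ?thesis by (simp only: pred_def space_borel UNIV_I simp_thms)
qed

text \<open>As \<open>k\<close> need not be a power of two, the missing \<open>2 ^ t mod k\<close> units of weight are put on
  the loops. A loop surviving the rounding spoils only its own vertex, so no invariance of the
  measure is needed to discard it.\<close>

lemma ex_almost_perfect_matching:
  assumes \<mu>: "prob_space \<mu>" "sets \<mu> = sets borel" and \<epsilon>: "\<epsilon> > 0"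
    and S [measurable]: "S \<in> sets VV" and SE: "S \<subseteq> E" and k: "0 < k"
  shows "\<exists>N. N \<in> sets VV \<and> N \<subseteq> S \<and>
    measure \<mu> {v. (outdeg S v = k \<and> indeg S v = k) \<and> \<not> (outdeg N v = 1 \<and> indeg N v = 1)} \<le> \<epsilon>"
proof -
  interpret prob_space \<mu> by fact
  obtain t where t: "real k / (\<epsilon> / 2) < 2 ^ t" using real_arch_pow[of 2 "real k / (\<epsilon> / 2)"] by auto
  define \<alpha> \<beta> where "\<alpha> = 2 ^ t div k" and "\<beta> = 2 ^ t mod k"
  have \<alpha>\<beta>: "\<alpha> * k + \<beta> = 2 ^ t" by (simp add: \<alpha>_def \<beta>_def)
  define w where "w e = (if e \<in> S then \<alpha> else if fst e = snd e then \<beta> else 0)" for e :: "'a \<times> 'a"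
  have "closed {e :: 'a \<times> 'a. fst e = snd e}" by (intro closed_Collect_eq continuous_intros)
  then have "{e :: 'a \<times> 'a. fst e = snd e} \<in> sets borel" by (rule borel_closed)
  then have "{e :: 'a \<times> 'a. fst e = snd e} \<in> sets VV" by (subst borel_prod)
  then have "{e \<in> space VV. fst e = snd e} \<in> sets VV" by simp
  then have w: "w \<in> measurable VV (count_space UNIV)"
    unfolding w_def using S by (intro measurable_If) auto
  have loop: "(v, v) \<notin> S" for v using SE E_irrefl by auto
  have edge: "w (v, h i v) = (if (v, h i v) \<in> S then \<alpha> else 0)" "w (h i v, v) = (if (h i v, v) \<in> S then \<alpha> else 0)"
    if "i < d" for i v
    using h_edge[OF that, of v] E_irrefl unfolding w_def by auto
  have weight: "out_weight u v = (\<Sum>i<d. u (v, h i v)) + u (v, v)"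
    "in_weight u v = (\<Sum>i<d. u (h i v, v)) + u (v, v)" for u v
    unfolding out_weight_def in_weight_def lessThan_Suc_atMost[symmetric] by (simp_all add: nbr_def)
  have w_uniform: "uniform (2 ^ t) w v" if "outdeg S v = k" "indeg S v = k" for v
  proof -
    have "(\<Sum>i<d. w (v, h i v)) = \<alpha> * outdeg S v" "(\<Sum>i<d. w (h i v, v)) = \<alpha> * indeg S v"
      unfolding outdeg_def indeg_def
      by (simp_all add: edge sum.If_cases Int_def)
    then show ?thesis using that \<alpha>\<beta> loop unfolding uniform_def weight by (simp add: w_def)
  qed
  obtain w' where w': "w' \<in> measurable VV (count_space UNIV)" "\<And>e. w e = 0 \<Longrightarrow> w' e = 0"
    "prob {v. uniform (2 ^ t) w v \<and> \<not> uniform 1 w' v} \<le> \<epsilon> / 2"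
    "2 ^ t * (\<integral>\<^sup>+v. of_nat (w' (v, v)) \<partial>\<mu>) \<le> (\<integral>\<^sup>+v. of_nat (w (v, v)) \<partial>\<mu>)"
    using ex_almost_unit_weight[OF \<mu> _ w, of "\<epsilon> / 2" t] \<epsilon> by auto
  note w'(1) [measurable]
  define N where "N = {e \<in> S. w' e \<noteq> 0}"
  define L where "L = {v. w' (v, v) \<noteq> 0}"
  have "{e \<in> space VV. e \<in> S \<and> w' e \<noteq> 0} \<in> sets VV" by measurable
  then have N: "N \<in> sets VV" unfolding N_def by simp
  have "{v \<in> space borel. w' (v, v) \<noteq> 0} \<in> sets borel" by measurable
  then have L: "L \<in> events" unfolding L_def \<mu>(2) by simp
  \<comment> \<open>Off \<open>L\<close> the loop is absent, so the weights of the \<open>d\<close>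
    edges on either side sum to 1 and exactly one is nonzero. It lies in \<open>S\<close> because
    zero weights stay zero.\<close>
  have matched: "outdeg N v = 1 \<and> indeg N v = 1" if "uniform 1 w' v" "v \<notin> L" for v
  proof -
    have "(v, h i v) \<in> N \<longleftrightarrow> w' (v, h i v) \<noteq> 0" "(h i v, v) \<in> N \<longleftrightarrow> w' (h i v, v) \<noteq> 0" if "i < d" for i
      using edge[OF that, of v] w'(2)[of "(v, h i v)"] w'(2)[of "(h i v, v)"] unfolding N_def
      by (auto split: if_splits)
    then have eq: "{i \<in> {..<d}. (v, h i v) \<in> N} = {i \<in> {..<d}. w' (v, h i v) \<noteq> 0}"
      "{i \<in> {..<d}. (h i v, v) \<in> N} = {i \<in> {..<d}. w' (h i v, v) \<noteq> 0}"
      by auto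
    have one: "card {i \<in> {..<d}. x i \<noteq> 0} = 1" if sum1: "(\<Sum>i<d. x i) = 1" for x :: "nat \<Rightarrow> nat"
    proof -
      obtain a where "a \<in> {..<d}" "x a = 1" "\<forall>b\<in>{..<d}. a \<noteq> b \<longrightarrow> x b = 0"
        using sum1 unfolding sum_eq_1_iff[OF finite_lessThan] by blast
      then have "{i \<in> {..<d}. x i \<noteq> 0} = {a}" by auto
      then show ?thesis by simp
    qed
    show ?thesis
      using that one[of "\<lambda>i. w' (v, h i v)"] one[of "\<lambda>i. w' (h i v, v)"]
      unfolding outdeg_def indeg_def eq uniform_def weight L_def by simp
  qed
  let ?A = "{v. uniform (2 ^ t) w v \<and> \<not> uniform 1 w' v}"
  have "{v. uniform (2 ^ t) w v} - {v. uniform 1 w' v} \<in> events"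
    using uniform_sets w w'(1) by (simp add: \<mu>(2) sets.Diff)
  then have A: "?A \<in> events" by (simp add: set_diff_eq)
  \<comment> \<open>Markov's inequality: weights are integers, so a surviving loop weighs at least
    1.\<close>
  have le: "indicator L v \<le> (of_nat (w' (v, v)) :: ennreal)" for v
    using of_nat_mono[of 1 "w' (v, v)", where 'a = ennreal] by (auto simp: L_def indicator_def)
  have "emeasure \<mu> L = (\<integral>\<^sup>+v. indicator L v \<partial>\<mu>)" using L by simp
  also have "\<dots> \<le> (\<integral>\<^sup>+v. of_nat (w' (v, v)) \<partial>\<mu>)"
    by (intro nn_integral_mono le)
  finally have "2 ^ t * emeasure \<mu> L \<le> 2 ^ t * (\<integral>\<^sup>+v. of_nat (w' (v, v)) \<partial>\<mu>)"
    by (rule mult_left_mono) simp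
  also have "\<dots> \<le> (\<integral>\<^sup>+v. of_nat (w (v, v)) \<partial>\<mu>)" by (rule w'(4))
  also have "\<dots> = of_nat \<beta>" using loop by (simp add: w_def emeasure_space_1)
  also have "\<dots> \<le> of_nat k" using k by (intro of_nat_mono) (simp add: \<beta>_def less_imp_le)
  finally have "ennreal (2 ^ t * prob L) \<le> ennreal (real k)"
    by (simp add: emeasure_eq_measure ennreal_mult ennreal_of_nat_eq_real_of_nat flip: ennreal_power)
  then have "2 ^ t * prob L \<le> real k" by simp
  moreover have "real k < 2 ^ t * (\<epsilon> / 2)" using t \<epsilon> by (simp add: pos_divide_less_eq)
  ultimately have "2 ^ t * prob L \<le> 2 ^ t * (\<epsilon> / 2)" by linarith
  then have L_small: "prob L \<le> \<epsilon> / 2" by (subst (asm) mult_le_cancel_left_pos) auto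
  have "{v. (outdeg S v = k \<and> indeg S v = k) \<and> \<not> (outdeg N v = 1 \<and> indeg N v = 1)} \<subseteq> ?A \<union> L"
    using matched w_uniform by blast
  then have "prob {v. (outdeg S v = k \<and> indeg S v = k) \<and> \<not> (outdeg N v = 1 \<and> indeg N v = 1)} \<le> prob (?A \<union> L)"
    using A L by (intro finite_measure_mono) auto
  also have "\<dots> \<le> prob ?A + prob L" by (rule measure_Un_le[OF A L])
  finally have "prob {v. (outdeg S v = k \<and> indeg S v = k) \<and> \<not> (outdeg N v = 1 \<and> indeg N v = 1)} \<le> \<epsilon>"
    using w'(3) L_small by linarith
  then show ?thesis using N by (intro exI[of _ N]) (auto simp: N_def)
qed

section \<open>Edge counts and rainbow vertices\<close>

lemma out_edges_eq:
  assumes "S \<subseteq> E"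
  shows "out_edges S v = (\<lambda>i. (v, h i v)) ` {i \<in> {..<d}. (v, h i v) \<in> S}"
proof -
  have "w \<in> (\<lambda>i. h i v) ` {..<d}" if "(v, w) \<in> S" for w using that assms h_section[of v] by blast
  then show ?thesis unfolding out_edges_def by force
qed

lemma in_edges_eq:
  assumes "S \<subseteq> E"
  shows "in_edges S v = (\<lambda>i. (h i v, v)) ` {i \<in> {..<d}. (h i v, v) \<in> S}"
proof -
  have "w \<in> (\<lambda>i. h i v) ` {..<d}" if "(w, v) \<in> S" for w
    using that assms E_sym[of w v] h_section[of v] by blast
  then show ?thesis unfolding in_edges_def by force
qed

lemma card_out_edges: "S \<subseteq> E \<Longrightarrow> finite (out_edges S v) \<and> card (out_edges S v) = outdeg S v"
  unfolding outdeg_def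
  by (auto simp: out_edges_eq intro!: card_image inj_onI dest: inj_onD[OF h_inj])

lemma card_in_edges: "S \<subseteq> E \<Longrightarrow> finite (in_edges S v) \<and> card (in_edges S v) = indeg S v"
  unfolding indeg_def
  by (auto simp: in_edges_eq intro!: card_image inj_onI dest: inj_onD[OF h_inj])

definition rainbow_at :: "('a \<times> 'a) set \<Rightarrow> ('a \<times> 'a \<Rightarrow> nat option) \<Rightarrow> 'a \<Rightarrow> bool" where
  "rainbow_at S c v \<longleftrightarrow> in_edges S v \<subseteq> dom c \<and> inj_on c (in_edges S v) \<and>
     out_edges S v \<subseteq> dom c \<and> inj_on c (out_edges S v)"

lemma rainbow_sets:
  assumes S [measurable]: "S \<in> sets VV" and "S \<subseteq> E" and c: "c \<in> measurable VV (count_space UNIV)"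
  shows "{v. rainbow_at S c v} \<in> sets borel"
proof -
  have *: "{v. (\<lambda>i. e i v) ` {i \<in> {..<d}. e i v \<in> S} \<subseteq> dom c \<and> inj_on c ((\<lambda>i. e i v) ` {i \<in> {..<d}. e i v \<in> S})}
     \<in> sets borel"
    if e: "\<And>i. i < d \<Longrightarrow> e i \<in> measurable borel VV" and inj: "\<And>v. inj_on (\<lambda>i. e i v) {..<d}"
    for e :: "nat \<Rightarrow> 'a \<Rightarrow> 'a \<times> 'a"
  proof -
    have in_S: "Measurable.pred borel (\<lambda>v. e i v \<in> S)" if "i < d" for i
      by (rule pred_sets2[OF S e[OF that]])
    have ce: "(\<lambda>v. c (e i v)) \<in> measurable borel (count_space UNIV)" if "i < d" for i
      by (rule measurable_compose[OF e[OF that] c])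
    have none: "Measurable.pred borel (\<lambda>v. c (e i v) = None)" if "i < d" for i
      by (rule measurable_compose[OF ce[OF that]]) simp
    have eq: "Measurable.pred borel (\<lambda>v. c (e i v) = c (e j v))" if "i < d" "j < d" for i j
    proof (rule measurable_compose_countable[OF _ ce[OF that(1)], where f = "\<lambda>x v. x = c (e j v)"])
      show "Measurable.pred borel (\<lambda>v. x = c (e j v))" for x
        by (rule measurable_compose[OF ce[OF that(2)]]) simp
    qed
    \<comment> \<open>Definedness and injectivity are expressed on the indices below
      \<open>d\<close>, as a finite Boolean combination of measurable conditions.\<close>
    have "Measurable.pred borel (\<lambda>v. (\<forall>i\<in>{..<d}. e i v \<in> S \<longrightarrow> \<not> c (e i v) = None) \<and>
        (\<forall>i\<in>{..<d}. \<forall>j\<in>{..<d} - {i}. e i v \<in> S \<and> e j v \<in> S \<longrightarrow> \<not> c (e i v) = c (e j v)))"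
      by (intro pred_intros_logic pred_intros_finite in_S none eq) auto
    moreover have "(\<lambda>i. e i v) ` {i \<in> {..<d}. e i v \<in> S} \<subseteq> dom c \<longleftrightarrow>
       (\<forall>i\<in>{..<d}. e i v \<in> S \<longrightarrow> \<not> c (e i v) = None)" for v by auto
    moreover have "inj_on c ((\<lambda>i. e i v) ` {i \<in> {..<d}. e i v \<in> S}) \<longleftrightarrow>
       (\<forall>i\<in>{..<d}. \<forall>j\<in>{..<d} - {i}. e i v \<in> S \<and> e j v \<in> S \<longrightarrow> \<not> c (e i v) = c (e j v))" for v
      using inj_onD[OF inj[of v]] unfolding inj_on_def by auto
    ultimately show ?thesis by (simp only: pred_def space_borel UNIV_I simp_thms)
  qed
  have "{v. in_edges S v \<subseteq> dom c \<and> inj_on c (in_edges S v)} \<in> sets borel"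
    unfolding in_edges_eq[OF assms(2)]
    by (rule *) (use measurable_edge_at(2) h_inj in \<open>auto simp: inj_on_def\<close>)
  moreover have "{v. out_edges S v \<subseteq> dom c \<and> inj_on c (out_edges S v)} \<in> sets borel"
    unfolding out_edges_eq[OF assms(2)]
    by (rule *) (use measurable_edge_at(1) h_inj in \<open>auto simp: inj_on_def\<close>)
  ultimately have "{v. in_edges S v \<subseteq> dom c \<and> inj_on c (in_edges S v)} \<inter>
      {v. out_edges S v \<subseteq> dom c \<and> inj_on c (out_edges S v)} \<in> sets borel" by (rule sets.Int)
  then show ?thesis by (simp add: rainbow_at_def Int_def)
qed

text \<open>Induction on the number of colours: a matching takes colour \<open>k\<close> and, where
  it is perfect, lowers both degrees from \<open>Suc k\<close> to \<open>k\<close>. The degree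
  condition is imposed vertex by vertex, so the remainder \<open>R\<close> may be irregular at
  vertices already charged.\<close>

lemma ex_almost_rainbow_coloring:
  assumes \<mu>: "prob_space \<mu>" "sets \<mu> = sets borel" and "\<epsilon> > 0"
    and "S \<in> sets VV" "S \<subseteq> E"
  shows "\<exists>c. c \<in> measurable VV (count_space UNIV) \<and> dom c \<subseteq> S \<and> (\<forall>e i. c e = Some i \<longrightarrow> i < k) \<and>
    measure \<mu> {v. (outdeg S v = k \<and> indeg S v = k) \<and> \<not> rainbow_at S c v} \<le> \<epsilon>"
  using assms(3-)
proof (induction k arbitrary: S \<epsilon>)
  case 0
  have empty: "out_edges S v = {} \<and> in_edges S v = {}" if "outdeg S v = 0" "indeg S v = 0" for v
    using that card_out_edges[OF \<open>S \<subseteq> E\<close>, of v] card_in_edges[OF \<open>S \<subseteq> E\<close>, of v] by (metis card_0_eq)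
  have "{v. (outdeg S v = 0 \<and> indeg S v = 0) \<and> \<not> rainbow_at S (\<lambda>_. None) v} = {}"
    using empty by (auto simp: rainbow_at_def)
  then show ?case using 0 by (intro exI[of _ "\<lambda>_. None"]) (simp del: Collect_empty_eq)
next
  case (Suc k)
  interpret prob_space \<mu> by fact
  note S = \<open>S \<in> sets VV\<close> and SE = \<open>S \<subseteq> E\<close>
  obtain N where N: "N \<in> sets VV" "N \<subseteq> S"
    "prob {v. (outdeg S v = Suc k \<and> indeg S v = Suc k) \<and> \<not> (outdeg N v = 1 \<and> indeg N v = 1)} \<le> \<epsilon> / 2"
    using ex_almost_perfect_matching[OF \<mu> _ S SE, of "\<epsilon> / 2" "Suc k"] Suc.prems(1) by auto
  define R where "R = S - N"
  have R: "R \<in> sets VV" "R \<subseteq> E" using S SE N by (auto simp: R_def)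
  obtain c' where c': "c' \<in> measurable VV (count_space UNIV)" "dom c' \<subseteq> R" "\<forall>e i. c' e = Some i \<longrightarrow> i < k"
    "prob {v. (outdeg R v = k \<and> indeg R v = k) \<and> \<not> rainbow_at R c' v} \<le> \<epsilon> / 2"
    using Suc.IH[OF _ R, of "\<epsilon> / 2"] Suc.prems(1) by auto
  define c where "c e = (if e \<in> N then Some k else c' e)" for e
  have c: "c \<in> measurable VV (count_space UNIV)"
    unfolding c_def using N(1) c'(1) by (intro measurable_If) auto
  have split: "out_edges S v = out_edges R v \<union> out_edges N v" "in_edges S v = in_edges R v \<union> in_edges N v"
    "out_edges R v \<inter> out_edges N v = {}" "in_edges R v \<inter> in_edges N v = {}" for v
    using N(2) unfolding R_def out_edges_def in_edges_def by auto
  have NE: "N \<subseteq> E" using N SE by auto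
  have deg: "outdeg S v = outdeg R v + outdeg N v" "indeg S v = indeg R v + indeg N v" for v
    using card_out_edges[OF SE, of v] card_out_edges[OF R(2), of v] card_out_edges[OF NE, of v]
      card_in_edges[OF SE, of v] card_in_edges[OF R(2), of v] card_in_edges[OF NE, of v]
      card_Un_disjoint[OF _ _ split(3), of v] card_Un_disjoint[OF _ _ split(4), of v] split(1,2)[of v]
    by auto
  have c_N: "c e = Some k" if "e \<in> out_edges N v \<or> e \<in> in_edges N v" for e v
    using that by (auto simp: c_def out_edges_def in_edges_def)
  have c_R: "c e = c' e" if "e \<in> out_edges R v \<or> e \<in> in_edges R v" for e v
    using that by (auto simp: c_def out_edges_def in_edges_def R_def)
  have rainbow: "rainbow_at S c v" if "rainbow_at R c' v" "outdeg N v = 1" "indeg N v = 1" for v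
  proof -
    have "card (out_edges N v) = 1" "card (in_edges N v) = 1"
      using card_out_edges[OF NE, of v] card_in_edges[OF NE, of v] that by auto
    then show ?thesis
      using that(1) c'(3) c_N c_R unfolding rainbow_at_def split
      by (intro conjI rainbow_insert[of _ c' k]) blast+
  qed
  let ?A = "{v. (outdeg S v = Suc k \<and> indeg S v = Suc k) \<and> \<not> (outdeg N v = 1 \<and> indeg N v = 1)}"
  let ?B = "{v. (outdeg R v = k \<and> indeg R v = k) \<and> \<not> rainbow_at R c' v}"
  have "{v. outdeg S v = Suc k \<and> indeg S v = Suc k} - {v. outdeg N v = 1 \<and> indeg N v = 1} \<in> events"
    unfolding \<mu>(2) by (intro sets.Diff regular_meas S N)
  then have A: "?A \<in> events" by (simp only: set_diff_eq mem_Collect_eq)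
  have "{v. outdeg R v = k \<and> indeg R v = k} - {v. rainbow_at R c' v} \<in> events"
    unfolding \<mu>(2) by (intro sets.Diff regular_meas rainbow_sets R c')
  then have B: "?B \<in> events" by (simp only: set_diff_eq mem_Collect_eq)
  have "{v. (outdeg S v = Suc k \<and> indeg S v = Suc k) \<and> \<not> rainbow_at S c v} \<subseteq> ?A \<union> ?B"
    using rainbow deg by auto
  then have "prob {v. (outdeg S v = Suc k \<and> indeg S v = Suc k) \<and> \<not> rainbow_at S c v} \<le> prob (?A \<union> ?B)"
    using A B by (intro finite_measure_mono) auto
  also have "\<dots> \<le> prob ?A + prob ?B" by (rule measure_Un_le[OF A B])
  finally have "prob {v. (outdeg S v = Suc k \<and> indeg S v = Suc k) \<and> \<not> rainbow_at S c v} \<le> \<epsilon>"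
    using N(3) c'(4) by linarith
  moreover have "dom c \<subseteq> S"
  proof
    fix e assume "e \<in> dom c"
    then have "e \<in> N \<or> e \<in> dom c'" by (auto simp: c_def dom_def split: if_splits)
    then show "e \<in> S" using c'(2) N(2) unfolding R_def by blast
  qed
  moreover have "\<forall>e i. c e = Some i \<longrightarrow> i < Suc k" using c'(3) unfolding c_def by (auto simp: less_Suc_eq)
  ultimately show ?case using c by blast
qed

end

theorem theorem1:
  fixes \<Delta> :: nat and E :: "('a::polish_space \<times> 'a) set"
  assumes "borel_graph E" and "regular_graph (2 * \<Delta>) E"
  shows "\<forall>(\<mu> :: 'a measure) (\<epsilon> :: real).
           prob_space \<mu> \<and> sets \<mu> = sets borel \<and> \<epsilon> > 0 \<longrightarrow>
           (\<exists>S c. orientation E S \<and> partial_edge_coloring E \<Delta> c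
              \<and> Corr_dec S c \<in> sets \<mu> \<and> measure \<mu> (Corr_dec S c) > 1 - \<epsilon>)"
proof (intro allI impI)
  fix \<mu> :: "'a measure" and \<epsilon> :: real
  assume "prob_space \<mu> \<and> sets \<mu> = sets borel \<and> \<epsilon> > 0"
  then have \<mu>: "prob_space \<mu>" "sets \<mu> = sets borel" and \<epsilon>: "\<epsilon> / 4 > 0" by auto
  interpret prob_space \<mu> by fact
  have E: "E \<in> sets borel"
    using assms(1) unfolding borel_graph_def by (subst borel_prod[symmetric]) simp
  have "\<exists>h :: nat \<Rightarrow> 'a \<Rightarrow> 'a. (\<forall>i<2 * \<Delta>. h i \<in> borel_measurable borel) \<and>
    (\<forall>x. inj_on (\<lambda>i. h i x) {..<2 * \<Delta>} \<and> {y. (x, y) \<in> E} = (\<lambda>i. h i x) ` {..<2 * \<Delta>})"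
    by (rule borel_enumeration_of_sections)
      (use assms(2) E in \<open>auto simp: regular_graph_def\<close>)
  then obtain h :: "nat \<Rightarrow> 'a \<Rightarrow> 'a" where h: "\<forall>i<2 * \<Delta>. h i \<in> borel_measurable borel"
    "\<forall>x. inj_on (\<lambda>i. h i x) {..<2 * \<Delta>} \<and> {y. (x, y) \<in> E} = (\<lambda>i. h i x) ` {..<2 * \<Delta>}" by blast
  interpret enumerated_graph E "2 * \<Delta>" h
    by unfold_locales (use assms h in \<open>auto simp: borel_graph_def\<close>)
  obtain S where S: "orientation E S" "prob {v. \<not> (2 * outdeg S v = 2 * \<Delta> \<and> 2 * indeg S v = 2 * \<Delta>)} \<le> \<epsilon> / 4"
    using ex_almost_balanced_orientation[OF \<mu> \<epsilon>] by auto
  have S_sets: "S \<in> sets VV" and SE: "S \<subseteq> E" and anti: "(x, y) \<in> S \<Longrightarrow> (y, x) \<notin> S" for x y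
    using S(1) unfolding orientation_def by blast+
  obtain c where c: "c \<in> measurable VV (count_space UNIV)" "dom c \<subseteq> S" "\<forall>e i. c e = Some i \<longrightarrow> i < \<Delta>"
    "prob {v. (outdeg S v = \<Delta> \<and> indeg S v = \<Delta>) \<and> \<not> rainbow_at S c v} \<le> \<epsilon> / 4"
    using ex_almost_rainbow_coloring[OF \<mu> \<epsilon> S_sets SE] by blast
  have c_None: "c e = None" if "e \<notin> S" for e using that c(2) by (metis domIff subsetD)
  \<comment> \<open>\<open>c\<close> lives on oriented edges only; the reversed edge receives the
    same colour. As \<open>S\<close> never contains both directions, the two clauses cannot
    conflict.\<close>
  define c' where "c' e = (if e \<in> S then c e else c (prod.swap e))" for e
  have "(\<lambda>e. c (prod.swap e)) \<in> measurable VV (count_space UNIV)"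
    by (rule measurable_compose[OF _ c(1)]) (simp add: measurable_pair_swap' prod.swap_def)
  then have c'_meas: "c' \<in> measurable VV (count_space UNIV)"
    unfolding c'_def using c(1) S_sets by (intro measurable_If) auto
  have coloring: "partial_edge_coloring E \<Delta> c'"
    unfolding partial_edge_coloring_def
  proof (intro conjI allI impI c'_meas)
    show "dom c' \<subseteq> E"
      using c(2) SE E_sym unfolding c'_def by (fastforce simp: dom_def split: if_splits)
    show "i < \<Delta>" if "c' e = Some i" for e i
      using that c(3) unfolding c'_def by (metis (full_types))
    show "c' (x, y) = c' (y, x)" if "(x, y) \<in> dom c'" for x y
      using that anti[of x y] unfolding c'_def by (cases "(x, y) \<in> S"; cases "(y, x) \<in> S") (auto simp: c_None)
  qed
  have same: "c' e = c e" if "e \<in> S" for e using that by (simp add: c'_def)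
  have "rainbow_at S c' v = rainbow_at S c v" for v
  proof -
    have "X \<subseteq> dom c' \<longleftrightarrow> X \<subseteq> dom c" "inj_on c' X = inj_on c X" if "X \<subseteq> S" for X
      using that same by (auto simp: dom_def subset_iff intro!: inj_on_cong)
    moreover have "in_edges S v \<subseteq> S" "out_edges S v \<subseteq> S" by (auto simp: in_edges_def out_edges_def)
    ultimately show ?thesis unfolding rainbow_at_def by simp
  qed
  then have dec: "Corr_dec S c' = {v. indeg S v = outdeg S v} \<inter> {v. rainbow_at S c v}"
    using card_out_edges[OF SE] card_in_edges[OF SE]
    by (auto simp: Corr_dec_def Corr_def rainbow_at_def eqpoll_iff_card)
  have "Measurable.pred borel (\<lambda>v. indeg S v = outdeg S v)"
    by (rule measurable_nat_nat[OF indeg_meas[OF S_sets] outdeg_meas[OF S_sets], of "(=)"])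
  then have "{v. indeg S v = outdeg S v} \<in> sets borel"
    by (simp only: pred_def space_borel UNIV_I simp_thms)
  then have dec_sets: "Corr_dec S c' \<in> events"
    unfolding dec \<mu>(2) by (intro sets.Int rainbow_sets S_sets SE c)
  let ?A = "{v. \<not> (2 * outdeg S v = 2 * \<Delta> \<and> 2 * indeg S v = 2 * \<Delta>)}"
  let ?B = "{v. (outdeg S v = \<Delta> \<and> indeg S v = \<Delta>) \<and> \<not> rainbow_at S c v}"
  have "?A = - {v. outdeg S v = \<Delta> \<and> indeg S v = \<Delta>}" by auto
  then have A: "?A \<in> events" unfolding \<mu>(2) using regular_meas[OF S_sets] borel_comp by metis
  have "{v. outdeg S v = \<Delta> \<and> indeg S v = \<Delta>} - {v. rainbow_at S c v} \<in> events"
    unfolding \<mu>(2) by (intro sets.Diff regular_meas rainbow_sets S_sets SE c)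
  then have B: "?B \<in> events" by (simp only: set_diff_eq mem_Collect_eq)
  have "space \<mu> - Corr_dec S c' \<subseteq> ?A \<union> ?B" unfolding dec by auto
  then have "prob (space \<mu> - Corr_dec S c') \<le> prob (?A \<union> ?B)"
    using A B by (intro finite_measure_mono) auto
  also have "\<dots> \<le> prob ?A + prob ?B" by (rule measure_Un_le[OF A B])
  \<comment> \<open>Two errors of a quarter add up to half of \<open>\<epsilon>\<close>, which
    leaves room for the strict inequality.\<close>
  finally have "1 - prob (Corr_dec S c') \<le> \<epsilon> / 2"
    using S(2) c(4) prob_compl[OF dec_sets] by linarith
  then have "prob (Corr_dec S c') > 1 - \<epsilon>" using \<epsilon> by linarith
  then show "\<exists>S c. orientation E S \<and> partial_edge_coloring E \<Delta> c
      \<and> Corr_dec S c \<in> sets \<mu> \<and> measure \<mu> (Corr_dec S c) > 1 - \<epsilon>"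
    using S(1) coloring dec_sets by blast
qed

end
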